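(* Let $p$ be a prime, $p>3$, and let $c\in D_p$ with $c^2\not\equiv -3\pmod p$. Then \[ c\sum_{k=(p+1)/2}^{\lfloor 2p/3\rfloor}\binom{3k}{k}\left(\frac{4}{9(c^2+3)}\right)^k\equiv \begin{cases} 0 \pmod{p}, & \text{if } c\in C_0(p);\\ 1 \pmod{p}, & \text{if } c\in C_1(p);\\ -1 \pmod{p}, & \text{if } c\in C_2(p). \end{cases} \]
   Context: $D_p$ is the set of rationals whose denominator is not divisible by $p$. Let $\omega=e^{2\pi i/3}$ and $\mathbb{Z}[\omega]$ the Eisenstein integers, with norm $N(a+b\omega)=a^2-ab+b^2$. For a prime $\pi$ of $\mathbb{Z}[\omega]$ with $N(\pi)\neq 3$ and $\alpha\in\mathbb{Z}[\omega]$, the cubic residue character $\left(\frac{\alpha}{\pi}\right)_3$ is $0$ if $\pi\mid\alpha$, and otherwise is the unique $\omega^j$ ($j\in\{0,1,2\}$) with $\alpha^{(N(\pi)-1)/3}\equiv\omega^j\pmod{\pi}$. For a rational prime $p\equiv 2\pmod 3$, $p$ is prime in $\mathbb{Z}[\omega]$ and $\left(\frac{\alpha}{p}\right)_3$ is this character (with $N(p)=p^2$); for $p\equiv 1\pmod 3$, write $p=\pi\bar\pi$ with $\pi$ primary ($\pi\equiv 2\pmod 3$) and set $\left(\frac{\alpha}{p}\right)_3=\left(\frac{\alpha}{\pi}\right)_3\left(\frac{\alpha}{\bar\pi}\right)_3$ (cubic Jacobi symbol). Elements of $D_p$ are reduced modulo these primes in the natural way. For $j\in\{0,1,2\}$,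 $C_j(p)=\{c\in D_p : \left(\frac{c+1+2\omega}{p}\right)_3=\omega^j\}$. *)

theory Defs
  imports Complex_Main "HOL-Computational_Algebra.Primes"
begin

text \<open>
  \<^term>\<open>Eis a b\<close> stands for \<open>a + b \<omega>\<close>, where \<open>\<omega>\<^sup>2 = - 1 - \<omega>\<close>; the embedding
  \<open>complex_of_eis\<close> below identifies this ring with the subring of the complex numbers
  generated by \<open>\<omega> = e\<^bsup>2\<pi>i/3\<^esup>\<close>.
\<close>

datatype eisenstein = Eis (eis_fst: int) (eis_snd: int)

lemma eis_eq_iff: "x = y \<longleftrightarrow> eis_fst x = eis_fst y \<and> eis_snd x = eis_snd y"
  by (cases x; cases y) simp

instantiation eisenstein :: comm_ring_1
begin

definition zero_eisenstein :: eisenstein where "0 = Eis 0 0"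

definition one_eisenstein :: eisenstein where "1 = Eis 1 0"

definition plus_eisenstein :: "eisenstein \<Rightarrow> eisenstein \<Rightarrow> eisenstein" where
  "x + y = Eis (eis_fst x + eis_fst y) (eis_snd x + eis_snd y)"

definition uminus_eisenstein :: "eisenstein \<Rightarrow> eisenstein" where
  "- x = Eis (- eis_fst x) (- eis_snd x)"

definition minus_eisenstein :: "eisenstein \<Rightarrow> eisenstein \<Rightarrow> eisenstein" where
  "x - y = Eis (eis_fst x - eis_fst y) (eis_snd x - eis_snd y)"

definition times_eisenstein :: "eisenstein \<Rightarrow> eisenstein \<Rightarrow> eisenstein" where
  "x * y = Eis (eis_fst x * eis_fst y - eis_snd x * eis_snd y)
               (eis_fst x * eis_snd y + eis_snd x * eis_fst y - eis_snd x * eis_snd y)"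

instance
  by standard
    (simp_all add: eis_eq_iff zero_eisenstein_def one_eisenstein_def plus_eisenstein_def
      uminus_eisenstein_def minus_eisenstein_def times_eisenstein_def algebra_simps)

end

definition omega :: eisenstein where
  "omega = Eis 0 1"

definition complex_of_eis :: "eisenstein \<Rightarrow> complex" where
  "complex_of_eis x = of_int (eis_fst x) + of_int (eis_snd x) * cis (2 * pi / 3)"

lemma cis_two_thirds_pi_square: "cis (2 * pi / 3) * cis (2 * pi / 3) = - 1 - cis (2 * pi / 3)"
  by (simp add: complex_eq_iff cos_120 sin_120)

lemma complex_of_eis_hom:
  "complex_of_eis 0 = 0" "complex_of_eis 1 = 1" "complex_of_eis omega = cis (2 * pi / 3)"
  "complex_of_eis (x + y) = complex_of_eis x + complex_of_eis y"
  "complex_of_eis (x * y) = complex_of_eis x * complex_of_eis y"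
proof -
  let ?w = "cis (2 * pi / 3)"
  let ?a = "of_int (eis_fst x) :: complex" and ?b = "of_int (eis_snd x) :: complex"
  let ?c = "of_int (eis_fst y) :: complex" and ?d = "of_int (eis_snd y) :: complex"
  have "complex_of_eis x * complex_of_eis y = ?a * ?c + (?a * ?d + ?b * ?c) * ?w + ?b * ?d * (?w * ?w)"
    unfolding complex_of_eis_def by (simp only: algebra_simps)
  also have "\<dots> = complex_of_eis (x * y)"
    unfolding cis_two_thirds_pi_square
    by (simp add: complex_of_eis_def times_eisenstein_def algebra_simps)
  finally show "complex_of_eis (x * y) = complex_of_eis x * complex_of_eis y" ..
qed (simp_all add: complex_of_eis_def zero_eisenstein_def one_eisenstein_def omega_def
       plus_eisenstein_def algebra_simps)

lemma inj_complex_of_eis: "inj complex_of_eis"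
proof (rule injI)
  fix x y assume "complex_of_eis x = complex_of_eis y"
  then have re: "Re (complex_of_eis x) = Re (complex_of_eis y)"
    and im: "Im (complex_of_eis x) = Im (complex_of_eis y)"
    by simp_all
  from im have "eis_snd x = eis_snd y"
    by (simp add: complex_of_eis_def sin_120)
  with re show "x = y"
    by (simp add: complex_of_eis_def eis_eq_iff)
qed

definition eis_norm :: "eisenstein \<Rightarrow> int" where
  "eis_norm x = (eis_fst x)\<^sup>2 - eis_fst x * eis_snd x + (eis_snd x)\<^sup>2"

text \<open>Complex conjugation maps \<open>\<omega>\<close> to \<open>\<omega>\<^sup>2 = - 1 - \<omega>\<close>.\<close>

definition eis_cnj :: "eisenstein \<Rightarrow> eisenstein" where
  "eis_cnj x = Eis (eis_fst x - eis_snd x) (- eis_snd x)"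

lemma complex_of_eis_cnj: "complex_of_eis (eis_cnj x) = cnj (complex_of_eis x)"
  by (simp add: complex_of_eis_def eis_cnj_def complex_eq_iff cos_120 sin_120)

text \<open>Only meaningful if \<open>\<pi>\<close> is a prime element with \<open>eis_norm \<pi> \<noteq> 3\<close>.\<close>

definition cubic_character :: "eisenstein \<Rightarrow> eisenstein \<Rightarrow> eisenstein" where
  "cubic_character \<pi> \<alpha> =
     (if \<pi> dvd \<alpha> then 0
      else (THE z. \<exists>j\<in>{0, 1, 2::nat}.
              z = omega ^ j \<and> \<pi> dvd (\<alpha> ^ nat ((eis_norm \<pi> - 1) div 3) - omega ^ j)))"

text \<open>
  For a prime \<open>p\<close> with \<open>p \<equiv> 1 (mod 3)\<close>, exactly two conjugate elements \<open>\<pi>\<close> qualify below,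
  and the symbol does not depend on which of them is chosen.
\<close>

definition primary_factor :: "nat \<Rightarrow> eisenstein" where
  "primary_factor p = (SOME \<pi>. of_nat p = \<pi> * eis_cnj \<pi> \<and> 3 dvd (\<pi> - 2))"

definition cubic_symbol :: "eisenstein \<Rightarrow> nat \<Rightarrow> eisenstein" where
  "cubic_symbol \<alpha> p =
     (if p mod 3 = 2 then cubic_character (of_nat p) \<alpha>
      else cubic_character (primary_factor p) \<alpha> * cubic_character (eis_cnj (primary_factor p)) \<alpha>)"

definition D :: "nat \<Rightarrow> rat set" where
  "D p = {c. \<not> int p dvd snd (quotient_of c)}"

definition rat_cong :: "nat \<Rightarrow> rat \<Rightarrow> rat \<Rightarrow> bool" where
  "rat_cong p x y \<longleftrightarrow> (\<exists>d\<in>D p. x - y = of_nat p * d)"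

text \<open>The reduction of an element of \<^term>\<open>D p\<close> modulo \<open>p\<close>, as an integer representative.\<close>

definition D_residue :: "nat \<Rightarrow> rat \<Rightarrow> int" where
  "D_residue p c = (THE a. 0 \<le> a \<and> a < int p \<and> rat_cong p c (of_int a))"

definition C :: "nat \<Rightarrow> nat \<Rightarrow> rat set" where
  "C j p = {c \<in> D p. cubic_symbol (of_int (D_residue p c) + 1 + 2 * omega) p = omega ^ j}"

end

theory Submission
  imports Defs "HOL-Number_Theory.Number_Theory"
begin

text \<open>
  Write \<open>p = 6 m + e\<close> with \<open>e = 1\<close> or \<open>e = - 1\<close>. For \<open>k = (p + 1) / 2 + i\<close> one has, modulo \<open>p\<close>,
  \<open>binom(3k, k) = binom(3k - p, 2i + 1) = - 9 e (- 27)\<^sup>i binom(m + i, 2i + 1)\<close>, since \<open>m\<close> is congruent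
  to \<open>- e / 6\<close>. With \<open>\<alpha> = c + \<surd>(- 3)\<close>, \<open>\<beta> = c - \<surd>(- 3)\<close> and \<open>N = \<alpha> \<beta> = c\<^sup>2 + 3\<close> this turns the sum into
  \<open>\<Sum>i. binom(m + i, 2i + 1) (\<alpha> \<beta>)\<^bsup>m - 1 - i\<^esup> (\<alpha> - \<beta>)\<^bsup>2i\<^esup> = (\<alpha>\<^bsup>2m\<^esup> - \<beta>\<^bsup>2m\<^esup>) / (\<alpha>\<^sup>2 - \<beta>\<^sup>2)\<close>, and \<open>S\<close> satisfies
  \<open>\<surd>(- 3) S N\<^bsup>m + (p - 1)/2\<^esup> = - e (\<alpha>\<^bsup>2m\<^esup> - \<beta>\<^bsup>2m\<^esup>)\<close> modulo \<open>p\<close>. As \<open>2 m = (p - e) / 3\<close>, the right-hand side is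
  determined by the cubic residue symbol \<open>s\<close> of \<open>\<alpha>\<close>: for \<open>e = 1\<close> directly modulo a prime factor of \<open>p\<close>,
  for \<open>e = - 1\<close> because \<open>\<alpha>\<^sup>p\<close> is congruent to \<open>\<beta>\<close> modulo \<open>p\<close>. In both cases
  \<open>\<surd>(- 3) S\<close> is congruent to \<open>s - s\<^sup>2\<close>, which is \<open>0\<close>, \<open>\<surd>(- 3)\<close> or \<open>- \<surd>(- 3)\<close> for \<open>s = 1, \<omega>, \<omega>\<^sup>2\<close>.
\<close>

subsection \<open>Binomial coefficients\<close>

text \<open>In Vandermonde's convolution every term with \<open>j > 0\<close> contains
  \<open>p choose j\<close>, which \<open>p\<close> divides because \<open>0 < j\<close> and
  \<open>j \<le> k < p\<close>. Only the term \<open>j = 0\<close> survives.\<close>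

lemma binomial_prime_add_cong:
  fixes p r k :: nat
  assumes "prime p" and "k < p"
  shows "[(p + r) choose k = r choose k] (mod p)"
proof -
  have "(p + r) choose k = (\<Sum>j\<le>k. (p choose j) * (r choose (k - j)))"
    by (rule vandermonde[symmetric])
  also have "\<dots> = (r choose k) + (\<Sum>j\<in>{..k} - {0}. (p choose j) * (r choose (k - j)))"
    by (subst sum.remove[of _ 0]) auto
  finally have eq: "(p + r) choose k = \<dots>" .
  have "p dvd (\<Sum>j\<in>{..k} - {0}. (p choose j) * (r choose (k - j)))"
    using assms by (intro dvd_sum dvd_mult2 dvd_choose_prime) auto
  then show ?thesis
    unfolding eq by (simp only: cong_add_lcancel_0_nat cong_0_iff)
qed

text \<open>The falling factorial clears the denominator, so its factors can be replaced modulo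
  \<open>p\<close> one by one. Integer subtraction keeps this valid for \<open>n < k\<close>, where
  the factor at \<open>t = n\<close> vanishes.\<close>

lemma fact_mult_binomial_int:
  "fact k * int (n choose k) = (\<Prod>t<k. int n - int t)"
proof -
  have "fact k * (real n gchoose k) = (\<Prod>t<k. real n - real t)"
    by (simp add: gbinomial_mult_fact atLeast0LessThan)
  then have "real_of_int (fact k * int (n choose k)) = real_of_int (\<Prod>t<k. int n - int t)"
    by (simp add: binomial_gbinomial)
  then show ?thesis
    by (simp only: of_int_eq_iff)
qed

text \<open>The two products are the scaled falling factorials of
  \<open>r choose (2 * i + 1)\<close> and \<open>(m + i) choose (2 * i + 1)\<close> that arise
  modulo \<open>p\<close> in \<open>binomial_triple_cong\<close>. Passing from \<open>i\<close> to
  \<open>i + 1\<close> multiplies both sides by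
  \<open>27 * (6 * i + 7) * (6 * i + 5)\<close>.\<close>

lemma triple_product_identity:
  fixes e :: int
  assumes "e\<^sup>2 = 1"
  shows "3 ^ (2 * i + 1) * (\<Prod>t<2 * i + 1. 3 + 6 * int i - 2 * int t) =
    - 9 * e * (- 27) ^ i * (\<Prod>t<2 * i + 1. 6 * int i - e - 6 * int t)"
proof (induction i)
  case 0
  show ?case using assms by (simp add: power2_eq_square)
next
  case (Suc i)
  let ?P = "\<lambda>i. \<Prod>t<2 * i + 1. 3 + 6 * int i - 2 * int t"
  let ?Q = "\<lambda>i. \<Prod>t<2 * i + 1. 6 * int i - e - 6 * int t"
  \<comment> \<open>\<open>R\<close> lacks the last factor \<open>2 * i + 3\<close> of
    \<open>?P i\<close>. The step to \<open>Suc i\<close> loses that factor and gains three larger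
    ones, among them \<open>6 * i + 9 = 3 * (2 * i + 3)\<close>, which restores it. In
    \<open>?Q\<close> one factor is gained at each end.\<close>
  define R where "R = (\<Prod>t<2 * i. 3 + 6 * int i - 2 * int t)"
  have P: "?P i = R * (2 * int i + 3)"
    by (simp add: R_def)
  have "?P (Suc i) = (\<Prod>t<Suc (Suc (Suc (2 * i))). 3 + 6 * int (Suc i) - 2 * int t)"
    by (simp add: numeral_3_eq_3)
  also have "\<dots> = (6 * int i + 9) * ((6 * int i + 7) * ((6 * int i + 5) * R))"
    by (simp only: prod.lessThan_Suc_shift) (simp add: R_def algebra_simps)
  finally have P': "?P (Suc i) = \<dots>" .
  have "?P (Suc i) = 3 * (6 * int i + 7) * (6 * int i + 5) * ?P i"
    unfolding P P' by (simp add: algebra_simps)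
  moreover have "?Q (Suc i) = (\<Prod>t<Suc (Suc (2 * i + 1)). 6 * int (Suc i) - e - 6 * int t)"
    by simp
  moreover have "\<dots> = (6 * int i + 6 - e) * (\<Prod>t<Suc (2 * i + 1). 6 * int i - e - 6 * int t)"
    by (simp only: prod.lessThan_Suc_shift) (simp add: algebra_simps)
  moreover have "(\<Prod>t<Suc (2 * i + 1). 6 * int i - e - 6 * int t) = ?Q i * (- 6 * int i - 6 - e)"
    by (simp only: prod.lessThan_Suc) (simp add: algebra_simps)
  ultimately have Pi: "?P (Suc i) = 3 * (6 * int i + 7) * (6 * int i + 5) * ?P i"
    and Qi: "?Q (Suc i) = (6 * int i + 6 - e) * (?Q i * (- 6 * int i - 6 - e))"
    by metis+
  have fac: "(6 * int i + 6 - e) * (- 6 * int i - 6 - e) = - ((6 * int i + 7) * (6 * int i + 5))"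
    using assms by (simp add: algebra_simps power2_eq_square)
  have "3 ^ (2 * Suc i + 1) * ?P (Suc i) =
      27 * ((6 * int i + 7) * (6 * int i + 5)) * (3 ^ (2 * i + 1) * ?P i)"
    unfolding Pi by (simp add: algebra_simps)
  also have "\<dots> = 27 * ((6 * int i + 7) * (6 * int i + 5)) * (- 9 * e * (- 27) ^ i * ?Q i)"
    by (simp only: Suc.IH)
  also have "\<dots> = - 9 * e * (- 27) ^ Suc i * (?Q i * (- ((6 * int i + 7) * (6 * int i + 5))))"
    by (simp add: algebra_simps)
  also have "\<dots> = - 9 * e * (- 27) ^ Suc i * ?Q (Suc i)"
    unfolding Qi fac[symmetric] by (simp only: mult_ac)
  finally show ?case .
qed

lemma binomial_triple_cong:
  fixes p m i :: nat and e :: int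
  assumes "prime p" and p: "int p = 6 * int m + e" and e: "e = 1 \<or> e = - 1" and "i < m"
  defines "k \<equiv> (p + 1) div 2 + i"
  shows "[int ((3 * k) choose k) = - 9 * e * (- 27) ^ i * int ((m + i) choose (2 * i + 1))]
    (mod int p)"
proof -
  define r where "r = 3 * k - p"
  have "odd (int p)" using p e by auto
  then have "odd p" by simp
  then have k: "2 * k = p + 1 + 2 * i"
    unfolding k_def by (auto elim!: oddE)
  have bounds: "k < p" "k \<le> r" "3 * k = p + r" "r - k = 2 * i + 1" "2 * i + 1 < p"
      "2 * r = p + 3 + 6 * i" "p > 3"
    using k p e \<open>i < m\<close> unfolding r_def by auto
  let ?n = "2 * i + 1"
  \<comment> \<open>\<open>?F\<close> clears the factorial and the denominators 2 and 3 of
    \<open>r\<close> and \<open>m\<close> modulo \<open>p\<close>. It is cancelled at the end, being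
    prime to \<open>p\<close> because \<open>2 * i + 1 < p\<close> and \<open>p > 3\<close>.\<close>
  let ?F = "6 ^ ?n * fact ?n :: int"
  have "[(3 * k) choose k = r choose k] (mod p)"
    unfolding bounds(3) using assms(1) bounds(1) by (rule binomial_prime_add_cong)
  also have "r choose k = r choose ?n"
    using binomial_symmetric[OF bounds(2)] bounds(4) by simp
  finally have "[int ((3 * k) choose k) = int (r choose ?n)] (mod int p)"
    by (simp only: cong_int_iff)
  then have "[?F * int ((3 * k) choose k) = ?F * int (r choose ?n)] (mod int p)"
    by (rule cong_scalar_left)
  also have "?F * int (r choose ?n) = 3 ^ ?n * (2 ^ ?n * (fact ?n * int (r choose ?n)))"
    using power_mult_distrib[of 3 "2::int" ?n] by (simp only: mult_ac) simp
  also have "2 ^ ?n * (fact ?n * int (r choose ?n)) = (\<Prod>t<?n. 2 * (int r - int t))"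
    unfolding fact_mult_binomial_int prod.distrib by simp
  also have "[3 ^ ?n * \<dots> = 3 ^ ?n * (\<Prod>t<?n. 3 + 6 * int i - 2 * int t)] (mod int p)"
  proof (intro cong_scalar_left cong_prod)
    fix t
    have "2 * (int r - int t) = 3 + 6 * int i - 2 * int t + int p"
      using arg_cong[OF bounds(6), of int] by simp
    then show "[2 * (int r - int t) = 3 + 6 * int i - 2 * int t] (mod int p)"
      by (simp only: cong_iff_dvd_diff) simp
  qed
  also have "3 ^ ?n * (\<Prod>t<?n. 3 + 6 * int i - 2 * int t) =
      - 9 * e * (- 27) ^ i * (\<Prod>t<?n. 6 * int i - e - 6 * int t)"
    using e by (intro triple_product_identity) auto
  also have "[\<dots> = - 9 * e * (- 27) ^ i * (\<Prod>t<?n. 6 * (int (m + i) - int t))] (mod int p)"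
  proof (intro cong_scalar_left cong_prod)
    fix t
    have "6 * (int (m + i) - int t) = 6 * int i - e - 6 * int t + int p"
      using p by simp
    then show "[6 * int i - e - 6 * int t = 6 * (int (m + i) - int t)] (mod int p)"
      by (simp only: cong_iff_dvd_diff) simp
  qed
  also have "(\<Prod>t<?n. 6 * (int (m + i) - int t)) = 6 ^ ?n * (fact ?n * int ((m + i) choose ?n))"
    unfolding fact_mult_binomial_int prod.distrib by simp
  finally have "[?F * int ((3 * k) choose k) =
      ?F * (- 9 * e * (- 27) ^ i * int ((m + i) choose ?n))] (mod int p)"
    by (simp only: mult_ac)
  moreover have "coprime ?F (int p)"
  proof -
    have "\<not> p dvd 6 ^ ?n * fact ?n"
    proof
      assume "p dvd 6 ^ ?n * fact ?n"
      then have "p dvd 6 ^ ?n \<or> p dvd fact ?n"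
        using assms(1) prime_dvd_mult_iff by blast
      moreover have "\<not> p dvd fact ?n"
        using assms(1) bounds(5) by (simp only: prime_dvd_fact_iff)
      ultimately have "p dvd 6"
        using assms(1) prime_dvd_power by blast
      then have "p dvd 2 * 3"
        by simp
      then have "p dvd 2 \<or> p dvd 3"
        using assms(1) prime_dvd_mult_iff by blast
      then show False
        using \<open>p > 3\<close> by (auto dest: dvd_imp_le)
    qed
    then have "coprime (6 ^ ?n * fact ?n) p"
      using assms(1) prime_imp_coprime coprime_commute by blast
    then have "coprime (int (6 ^ ?n * fact ?n)) (int p)"
      by (simp only: coprime_int_iff)
    then show ?thesis
      by (simp only: of_nat_mult of_nat_power of_nat_fact of_nat_numeral)
  qed
  ultimately show ?thesis
    using cong_mult_lcancel by blast
qed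

text \<open>The sums are coupled by Pascal's rule, \<open>F (m + 1) = N * F m + G m\<close> and
  \<open>G (m + 1) = N * G m + d * F (m + 1)\<close> with \<open>N = u * v\<close> and
  \<open>d = (u - v)^2\<close>, so both are proved in one induction. The factors
  \<open>u^2 - v^2\<close> and \<open>u + v\<close> stay on the left because the ring need not allow
  division.\<close>

lemma lucas_sum_identities:
  fixes u v :: "'a::comm_ring_1"
  shows "(u\<^sup>2 - v\<^sup>2) *
      (\<Sum>i<m. of_nat ((m + i) choose (2 * i + 1)) * (u * v) ^ (m - 1 - i) * ((u - v)\<^sup>2) ^ i) =
      u ^ (2 * m) - v ^ (2 * m)" (is "_ * ?F m = _")
    and "(u + v) * (\<Sum>i\<le>m. of_nat ((m + i) choose (2 * i)) * (u * v) ^ (m - i) * ((u - v)\<^sup>2) ^ i) =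
      u ^ (2 * m + 1) + v ^ (2 * m + 1)" (is "_ * ?G m = _")
proof (induction m)
  case 0
  show "(u\<^sup>2 - v\<^sup>2) * ?F 0 = u ^ (2 * 0) - v ^ (2 * 0)"
    and "(u + v) * ?G 0 = u ^ (2 * 0 + 1) + v ^ (2 * 0 + 1)" by simp_all
next
  case (Suc m)
  let ?N = "u * v" and ?d = "(u - v)\<^sup>2"
  have F: "?F (Suc m) = ?N * ?F m + ?G m"
  proof -
    have "?F (Suc m) = (\<Sum>i\<le>m. of_nat ((m + i) choose (2 * i + 1)) * ?N ^ (m - i) * ?d ^ i) + ?G m"
      unfolding sum.distrib[symmetric] lessThan_Suc_atMost
      by (intro sum.cong) (simp_all add: algebra_simps)
    \<comment> \<open>The term \<open>i = m\<close> is zero, as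
      \<open>2 * m < 2 * m + 1\<close>.\<close>
    also have "(\<Sum>i\<le>m. of_nat ((m + i) choose (2 * i + 1)) * ?N ^ (m - i) * ?d ^ i) =
        (\<Sum>i<m. of_nat ((m + i) choose (2 * i + 1)) * ?N ^ (m - i) * ?d ^ i)"
      by (simp add: lessThan_Suc_atMost[symmetric] binomial_eq_0)
    also have "\<dots> = ?N * ?F m"
      unfolding sum_distrib_left
    proof (intro sum.cong refl)
      fix i assume "i \<in> {..<m}"
      then have "m - i = Suc (m - 1 - i)" by auto
      then show "of_nat ((m + i) choose (2 * i + 1)) * ?N ^ (m - i) * ?d ^ i =
          ?N * (of_nat ((m + i) choose (2 * i + 1)) * ?N ^ (m - 1 - i) * ?d ^ i)"
        by (simp only: power_Suc mult_ac)
    qed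
    finally show ?thesis .
  qed
  have G: "?G (Suc m) = ?N * ?G m + ?d * ?F (Suc m)"
  proof -
    \<comment> \<open>The term \<open>i = 0\<close> is split off so that Pascal's rule applies to
      the shifted rest. That term later becomes the \<open>i = 0\<close> term of
      \<open>?N * ?G m\<close>.\<close>
    have "?G (Suc m) = ?N ^ Suc m + (\<Sum>i\<le>m. of_nat ((m + 1 + Suc i) choose (2 * i + 2)) * ?N ^ (m - i) * ?d ^ Suc i)"
      by (subst sum.atMost_Suc_shift) (simp del: power_Suc binomial_Suc_Suc)
    also have "(\<Sum>i\<le>m. of_nat ((m + 1 + Suc i) choose (2 * i + 2)) * ?N ^ (m - i) * ?d ^ Suc i) =
        (\<Sum>i\<le>m. of_nat ((m + Suc i) choose (2 * i + 2)) * ?N ^ (m - i) * ?d ^ Suc i)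
        + ?d * ?F (Suc m)"
      unfolding sum_distrib_left lessThan_Suc_atMost sum.distrib[symmetric]
      by (intro sum.cong) (simp_all add: algebra_simps)
    also have "(\<Sum>i\<le>m. of_nat ((m + Suc i) choose (2 * i + 2)) * ?N ^ (m - i) * ?d ^ Suc i) =
        (\<Sum>i<m. of_nat ((m + Suc i) choose (2 * i + 2)) * ?N ^ (m - i) * ?d ^ Suc i)"
      by (simp add: lessThan_Suc_atMost[symmetric] binomial_eq_0)
    also have "\<dots> = (\<Sum>i<m. ?N * (of_nat ((m + Suc i) choose (2 * Suc i)) * ?N ^ (m - Suc i) * ?d ^ Suc i))"
    proof (intro sum.cong refl)
      fix i assume "i \<in> {..<m}"
      then have "m - i = Suc (m - Suc i)" by auto
      then show "of_nat ((m + Suc i) choose (2 * i + 2)) * ?N ^ (m - i) * ?d ^ Suc i =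
          ?N * (of_nat ((m + Suc i) choose (2 * Suc i)) * ?N ^ (m - Suc i) * ?d ^ Suc i)"
        by (simp only: power_Suc mult_ac) simp
    qed
    also have "?N ^ Suc m + (\<dots> + ?d * ?F (Suc m)) = ?N * ?G m + ?d * ?F (Suc m)"
      by (simp add: sum.lessThan_Suc_shift lessThan_Suc_atMost[symmetric] sum_distrib_left distrib_left
            del: sum.lessThan_Suc binomial_Suc_Suc)
    finally show ?thesis .
  qed
  \<comment> \<open>Splitting \<open>u^2 - v^2\<close> as \<open>(u - v) * (u + v)\<close> makes the
    induction hypothesis for \<open>?G m\<close> applicable.\<close>
  have "(u\<^sup>2 - v\<^sup>2) * ?F (Suc m) = ?N * ((u\<^sup>2 - v\<^sup>2) * ?F m) + (u - v) * ((u + v) * ?G m)"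
    unfolding F by (simp add: algebra_simps power2_eq_square)
  also have "\<dots> = u ^ (2 * Suc m) - v ^ (2 * Suc m)"
    unfolding Suc.IH by (simp add: algebra_simps)
  finally show F': "(u\<^sup>2 - v\<^sup>2) * ?F (Suc m) = u ^ (2 * Suc m) - v ^ (2 * Suc m)" .
  have "(u + v) * ?G (Suc m) = ?N * ((u + v) * ?G m) + (u - v) * ((u\<^sup>2 - v\<^sup>2) * ?F (Suc m))"
    unfolding G by (simp add: algebra_simps power2_eq_square)
  also have "\<dots> = u ^ (2 * Suc m + 1) + v ^ (2 * Suc m + 1)"
    unfolding Suc.IH F' by (simp add: algebra_simps)
  finally show "(u + v) * ?G (Suc m) = u ^ (2 * Suc m + 1) + v ^ (2 * Suc m + 1)" .
qed

subsection \<open>Congruences in commutative rings\<close>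

text \<open>Phrased through divisibility, so that it makes sense for Eisenstein integers with only
  their ring structure.\<close>

definition ring_cong :: "'a::comm_ring_1 \<Rightarrow> 'a \<Rightarrow> 'a \<Rightarrow> bool" where
  "ring_cong q x y \<longleftrightarrow> q dvd x - y"

lemma ring_cong_refl [simp]: "ring_cong q x x"
  by (simp add: ring_cong_def)

lemma ring_cong_sym: "ring_cong q x y \<Longrightarrow> ring_cong q y x"
  unfolding ring_cong_def by (metis dvd_minus_iff minus_diff_eq)

lemma ring_cong_trans [trans]: "ring_cong q x y \<Longrightarrow> ring_cong q y z \<Longrightarrow> ring_cong q x z"
  unfolding ring_cong_def using dvd_add[of q "x - y" "y - z"] by simp

lemma ring_cong_add: "ring_cong q x y \<Longrightarrow> ring_cong q z w \<Longrightarrow> ring_cong q (x + z) (y + w)"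
  unfolding ring_cong_def using dvd_add[of q "x - y" "z - w"] by (simp add: algebra_simps)

lemma ring_cong_diff: "ring_cong q x y \<Longrightarrow> ring_cong q z w \<Longrightarrow> ring_cong q (x - z) (y - w)"
  unfolding ring_cong_def using dvd_diff[of q "x - y" "z - w"] by (simp add: algebra_simps)

lemma ring_cong_minus: "ring_cong q x y \<Longrightarrow> ring_cong q (- x) (- y)"
  using ring_cong_diff[of q 0 0 x y] by simp

lemma ring_cong_mult: "ring_cong q x y \<Longrightarrow> ring_cong q z w \<Longrightarrow> ring_cong q (x * z) (y * w)"
proof -
  assume "ring_cong q x y" "ring_cong q z w"
  then have "q dvd (x - y) * z + y * (z - w)"
    by (simp add: ring_cong_def)
  then show ?thesis by (simp add: ring_cong_def algebra_simps)
qed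

lemma ring_cong_power: "ring_cong q x y \<Longrightarrow> ring_cong q (x ^ n) (y ^ n)"
  by (induction n) (simp_all add: ring_cong_mult)

lemma ring_cong_dvd_iff: "ring_cong q x y \<Longrightarrow> q dvd x \<longleftrightarrow> q dvd y"
  unfolding ring_cong_def using dvd_add_right_iff[of q "x - y" y] by simp

lemma ring_cong_of_int:
  assumes "[x = y] (mod int p)" and "q dvd of_nat p"
  shows "ring_cong q (of_int x) (of_int y :: 'a::comm_ring_1)"
proof -
  from assms(1) obtain z where "x - y = int p * z"
    by (auto simp: cong_iff_dvd_diff)
  then have "of_int x - of_int y = (of_nat p * of_int z :: 'a)"
    by (metis of_int_diff of_int_mult of_int_of_nat_eq)
  then show ?thesis
    using assms(2) by (simp add: ring_cong_def)
qed

subsection \<open>Eisenstein integers\<close>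

lemma of_nat_eis: "of_nat n = Eis (int n) 0"
  by (induction n) (simp_all add: zero_eisenstein_def one_eisenstein_def plus_eisenstein_def)

lemma of_int_eis: "of_int n = Eis n 0"
  by (cases n) (simp_all add: of_nat_eis uminus_eisenstein_def one_eisenstein_def
      minus_eisenstein_def)

lemma numeral_eis: "numeral n = Eis (numeral n) 0"
  using of_int_eis[of "numeral n"] by simp

lemmas eis_arith = zero_eisenstein_def one_eisenstein_def plus_eisenstein_def
  uminus_eisenstein_def minus_eisenstein_def times_eisenstein_def of_int_eis of_nat_eis
  numeral_eis omega_def eis_cnj_def

lemma omega_square: "omega\<^sup>2 = - 1 - omega"
  by (simp add: power2_eq_square eis_arith)

lemma omega_cube: "omega ^ 3 = 1"
  by (simp add: power3_eq_cube eis_arith)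

text \<open>Explicit coordinates turn claims about cube roots of unity into finite case
  checks.\<close>

lemma cube_roots_eis: "{1, omega, omega\<^sup>2} = {Eis 1 0, Eis 0 1, Eis (- 1) (- 1)}"
  unfolding omega_square by (simp add: eis_arith)

lemma eis_cnj_diff: "eis_cnj (x - y) = eis_cnj x - eis_cnj y"
  and eis_cnj_mult: "eis_cnj (x * y) = eis_cnj x * eis_cnj y"
  and eis_cnj_one: "eis_cnj 1 = 1"
  and eis_cnj_cnj: "eis_cnj (eis_cnj x) = x"
  by (simp_all add: eis_eq_iff eis_arith algebra_simps)

lemma eis_cnj_power: "eis_cnj (x ^ n) = eis_cnj x ^ n"
  by (induction n) (simp_all add: eis_cnj_mult eis_cnj_one)

lemma eis_mult_cnj: "x * eis_cnj x = of_int (eis_norm x)"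
  by (simp add: eis_eq_iff eis_arith eis_norm_def algebra_simps power2_eq_square)

lemma eis_norm_mult: "eis_norm (x * y) = eis_norm x * eis_norm y"
  by (simp add: eis_norm_def eis_arith power2_eq_square algebra_simps)

lemma eis_norm_cnj: "eis_norm (eis_cnj x) = eis_norm x"
  by (simp add: eis_norm_def eis_cnj_def power2_eq_square algebra_simps)

lemma eis_norm_of_int: "eis_norm (of_int n) = n\<^sup>2"
  by (simp add: eis_norm_def of_int_eis)

lemma of_int_dvd_eis_iff: "of_int n dvd x \<longleftrightarrow> n dvd eis_fst x \<and> n dvd eis_snd x"
proof
  assume "of_int n dvd x"
  then obtain y where "x = of_int n * y" ..
  then show "n dvd eis_fst x \<and> n dvd eis_snd x"
    by (simp add: of_int_eis times_eisenstein_def)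
next
  assume "n dvd eis_fst x \<and> n dvd eis_snd x"
  then obtain c d where "eis_fst x = n * c" "eis_snd x = n * d"
    by (auto elim!: dvdE)
  then have "x = of_int n * Eis c d"
    by (simp add: eis_eq_iff of_int_eis times_eisenstein_def)
  then show "of_int n dvd x" ..
qed

lemma eis_cnj_dvd: "x dvd y \<Longrightarrow> eis_cnj x dvd eis_cnj y"
  by (auto simp: dvd_def eis_cnj_mult)

text \<open>The role of \<open>q\<close> is played by \<open>p\<close> itself or by a prime divisor of \<open>p\<close>.\<close>

locale eis_prime_over =
  fixes q :: eisenstein and p :: nat
  assumes prime_p: "prime p" and p_gt_3: "p > 3"
    and dvd_p: "q dvd of_nat p"
    and of_int_dvdD: "q dvd of_int n \<Longrightarrow> int p dvd n"
    and prime_dvd_multD: "q dvd x * y \<Longrightarrow> q dvd x \<or> q dvd y"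
begin

text \<open>Otherwise \<open>q dvd 3\<close>, which forces \<open>p dvd 3\<close>. This serves for
  differences of cube roots of unity and for \<open>1 + 2 * omega\<close>.\<close>

lemma not_dvd_if_dvd_3: "x dvd 3 \<Longrightarrow> \<not> q dvd x"
proof
  assume "x dvd 3" "q dvd x"
  then have "q dvd of_int 3"
    by (metis dvd_trans of_int_numeral)
  then have "int p dvd 3" by (rule of_int_dvdD)
  then show False using p_gt_3 by (auto dest: zdvd_imp_le)
qed

text \<open>Distinct cube roots of unity differ by an element of norm 3, hence by a divisor of 3.
  This gives the uniqueness of the value of the cubic character.\<close>

lemma not_dvd_diff_cube_roots:
  assumes "z \<in> {1, omega, omega\<^sup>2}" "w \<in> {1, omega, omega\<^sup>2}" "q dvd z - w"
  shows "z = w"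
proof (rule ccontr)
  assume "z \<noteq> w"
  have "z \<in> {Eis 1 0, Eis 0 1, Eis (- 1) (- 1)}" "w \<in> {Eis 1 0, Eis 0 1, Eis (- 1) (- 1)}"
    using assms(1,2) unfolding cube_roots_eis .
  with \<open>z \<noteq> w\<close>
  have cases: "z - w \<in> {Eis 1 (- 1), Eis (- 1) 1, Eis 2 1, Eis (- 2) (- 1), Eis 1 2, Eis (- 1) (- 2)}"
    by (elim insertE) (simp_all add: minus_eisenstein_def)
  have "3 = Eis 2 1 * Eis 1 (- 1)" "3 = Eis (- 2) (- 1) * Eis (- 1) 1" "3 = Eis 1 2 * Eis (- 1) (- 2)"
    by (simp_all add: eis_arith)
  with cases have "z - w dvd 3"
    by (elim insertE) (metis dvd_triv_left dvd_triv_right emptyE)+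
  then show False
    using not_dvd_if_dvd_3 assms(3) by blast
qed

lemma cube_root_exists:
  assumes "ring_cong q (x ^ 3) 1"
  shows "\<exists>z\<in>{1, omega, omega\<^sup>2}. ring_cong q x z"
proof -
  have "x ^ 3 - 1 = (x - 1) * ((x - omega) * (x - omega\<^sup>2))"
    unfolding omega_square by (cases x) (simp add: power3_eq_cube eis_arith algebra_simps)
  then have "q dvd (x - 1) * ((x - omega) * (x - omega\<^sup>2))"
    using assms by (simp add: ring_cong_def)
  then show ?thesis
    using prime_dvd_multD by (auto simp: ring_cong_def)
qed

text \<open>The third assumption is Fermat's theorem modulo \<open>q\<close>; it makes
  \<open>x ^ E\<close> a cube root of 1, so the \<open>THE\<close> in \<open>cubic_character\<close>
  has exactly one candidate. Split and inert primes supply this assumption in different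
  ways.\<close>

lemma cubic_character_cong:
  assumes "\<not> q dvd x" and "eis_norm q = 3 * int E + 1" and "ring_cong q (x ^ (3 * E)) 1"
  shows "cubic_character q x \<in> {1, omega, omega\<^sup>2}"
    and "ring_cong q (x ^ E) (cubic_character q x)"
proof -
  have "nat ((eis_norm q - 1) div 3) = E"
    using assms(2) by simp
  then have eq: "cubic_character q x =
      (THE z. z \<in> {1, omega, omega\<^sup>2} \<and> ring_cong q (x ^ E) z)"
    using assms(1) unfolding cubic_character_def ring_cong_def
    by (auto intro!: arg_cong[where f = The])
  have "ring_cong q ((x ^ E) ^ 3) 1"
    using assms(3) by (simp add: power_mult[symmetric] mult.commute)
  then obtain z where z: "z \<in> {1, omega, omega\<^sup>2}" "ring_cong q (x ^ E) z"
    using cube_root_exists by blast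
  have "w = z" if w: "w \<in> {1, omega, omega\<^sup>2}" "ring_cong q (x ^ E) w" for w
  proof -
    have "ring_cong q w z"
      using w(2) z(2) ring_cong_sym ring_cong_trans by blast
    then show ?thesis
      using not_dvd_diff_cube_roots w(1) z(1) unfolding ring_cong_def by blast
  qed
  then have "cubic_character q x = z"
    unfolding eq using z by blast
  with z show "cubic_character q x \<in> {1, omega, omega\<^sup>2}"
    "ring_cong q (x ^ E) (cubic_character q x)" by auto
qed

end

text \<open>Writing \<open>q = e + f \<omega>\<close>, the coefficient \<open>f\<close> is
  invertible modulo \<open>p\<close>, so \<omega> is congruent to the integer \<open>- e / f\<close>
  and every residue class modulo \<open>q\<close> contains an integer. Primality of \<open>q\<close>
  is thereby inherited from \<open>p\<close>.\<close>

lemma eis_prime_over_norm: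
  assumes "prime p" and "p > 3" and norm: "eis_norm q = int p"
  shows "eis_prime_over q p" and "\<exists>n. ring_cong q x (of_int n)"
proof -
  obtain e f where q: "q = Eis e f" by (cases q)
  have dvd_p: "q dvd of_nat p"
    by (metis dvd_triv_left eis_mult_cnj norm of_int_of_nat_eq)
  have dvdD: "int p dvd n" if "q dvd of_int n" for n
  proof -
    from that obtain y where "of_int n = q * y" ..
    then have "n\<^sup>2 = int p * eis_norm y"
      by (metis eis_norm_mult eis_norm_of_int norm)
    then have "int p dvd n\<^sup>2" by simp
    then show ?thesis
      using assms(1) by (simp add: prime_dvd_power_iff)
  qed
  \<comment> \<open>If \<open>p\<close> divided \<open>f\<close>, it would divide \<open>e\<close>
    as well, and then \<open>p^2\<close> would divide the norm \<open>p\<close>.\<close>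
  have "\<not> int p dvd f"
  proof
    assume f: "int p dvd f"
    have "int p = e\<^sup>2 - e * f + f\<^sup>2"
      using norm by (simp add: q eis_norm_def)
    then have "e\<^sup>2 = int p + f * (e - f)"
      by (simp add: power2_eq_square algebra_simps)
    then have "int p dvd e\<^sup>2" using f by simp
    then have "int p dvd e"
      using assms(1) by (simp add: prime_dvd_power_iff)
    with f obtain g h where gh: "e = int p * g" "f = int p * h"
      by blast
    have "int p * (int p * (g\<^sup>2 - g * h + h\<^sup>2)) = e\<^sup>2 - e * f + f\<^sup>2"
      unfolding gh by (simp add: power2_eq_square algebra_simps)
    also have "\<dots> = int p * 1"
      using \<open>int p = e\<^sup>2 - e * f + f\<^sup>2\<close> by simp
    finally have "int p * (g\<^sup>2 - g * h + h\<^sup>2) = 1"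
      using assms(2) by (subst (asm) mult_cancel_left) auto
    then have "int p dvd 1" by (metis dvd_triv_left)
    then show False using assms(2) by auto
  qed
  then have "coprime f (int p)"
    using assms(1) prime_imp_coprime[of "int p" f] by (simp add: coprime_commute)
  then obtain f' where "[f * f' = 1] (mod int p)"
    using cong_solve_coprime_int by blast
  then have f': "ring_cong q (of_int f * of_int f') 1"
    using ring_cong_of_int[OF _ dvd_p, of "f * f'" 1] by simp
  have om: "ring_cong q omega (of_int (- (e * f')))"
  proof -
    have "ring_cong q (of_int e + of_int f * omega) 0"
      by (simp add: ring_cong_def q eis_arith)
    \<comment> \<open>The left-hand side collapses to \<open>omega + e * f'\<close>.\<close>
    then have "ring_cong q ((of_int e + of_int f * omega) * of_int f' -
        (of_int f * of_int f' - 1) * omega) (0 * of_int f' - (1 - 1) * omega)"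
      by (intro ring_cong_diff ring_cong_mult f' ring_cong_refl)
    then have "ring_cong q (omega - of_int (- (e * f'))) 0"
      by (simp add: algebra_simps)
    then show ?thesis by (simp add: ring_cong_def)
  qed
  have ex: "\<exists>n. ring_cong q x (of_int n)" for x
  proof -
    have "x = of_int (eis_fst x) + of_int (eis_snd x) * omega"
      by (simp add: eis_eq_iff eis_arith)
    moreover have "ring_cong q \<dots> (of_int (eis_fst x) + of_int (eis_snd x) * of_int (- (e * f')))"
      by (intro ring_cong_add ring_cong_mult om ring_cong_refl)
    ultimately have "ring_cong q x (of_int (eis_fst x + eis_snd x * (- (e * f'))))"
      by simp
    then show ?thesis ..
  qed
  show "\<exists>n. ring_cong q x (of_int n)" by (rule ex)
  show "eis_prime_over q p"
  proof
    fix x y assume xy: "q dvd x * y"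
    obtain a b where ab: "ring_cong q x (of_int a)" "ring_cong q y (of_int b)"
      using ex by metis
    then have "ring_cong q (x * y) (of_int (a * b))"
      by (simp add: ring_cong_mult)
    with xy have "q dvd of_int (a * b)"
      by (simp only: ring_cong_dvd_iff)
    then have "int p dvd a * b"
      by (rule dvdD)
    then have "int p dvd a \<or> int p dvd b"
      using assms(1) by (simp add: prime_dvd_mult_iff)
    then have "q dvd of_int a \<or> q dvd of_int b"
      using ring_cong_of_int[OF iffD2[OF cong_0_iff] dvd_p] by (auto simp: ring_cong_def)
    then show "q dvd x \<or> q dvd y"
      using ab by (simp only: ring_cong_dvd_iff)
  qed (use assms dvd_p dvdD in auto)
qed

section \<open>Fermat's theorem, inert primes and the Frobenius map\<close>

lemma fermat_int:
  fixes a :: int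
  assumes "prime p" and "\<not> int p dvd a"
  shows "[a ^ (p - 1) = 1] (mod int p)"
proof -
  define b where "b = nat (a mod int p)"
  have p: "int p > 0" using assms(1) prime_gt_0_nat by simp
  have b: "[int b = a] (mod int p)"
    using p by (simp add: b_def cong_def)
  then have "\<not> p dvd b"
    using assms(2) cong_dvd_iff cong_sym by (metis cong_0_iff cong_trans int_dvd_int_iff)
  then have "[b ^ (p - 1) = 1] (mod p)"
    using assms(1) by (rule fermat_theorem[rotated])
  then have "[int b ^ (p - 1) = 1] (mod int p)"
    by (metis cong_int_iff of_nat_1 of_nat_power)
  then show ?thesis
    using cong_pow[OF b] cong_sym cong_trans by blast
qed

lemma fermat_int':
  fixes a :: int
  assumes "prime p"
  shows "[a ^ p = a] (mod int p)"
proof (cases "int p dvd a")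
  case True
  moreover from this have "int p dvd a ^ p"
    using assms prime_gt_0_nat[of p] by (meson dvd_power dvd_trans)
  ultimately show ?thesis
    by (simp add: cong_iff_dvd_diff)
next
  case False
  have "a ^ p = a * a ^ (p - 1)"
    using assms prime_gt_0_nat[of p] by (cases p) auto
  then show ?thesis
    using cong_scalar_left[OF fermat_int[OF assms False], of a] by simp
qed

text \<open>Cubing is injective modulo such a \<open>p\<close>, because
  \<open>x ^ (2 * p - 1)\<close> is congruent to \<open>x\<close> and \<open>2 * p - 1\<close> is a
  multiple of 3. From \<open>a ^ 3\<close> congruent to \<open>(- b) ^ 3\<close> one gets
  \<open>a\<close> congruent to \<open>- b\<close>, and the form becomes
  \<open>3 * a^2\<close>.\<close>

lemma dvd_norm_inertD:
  fixes a b :: int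
  assumes "prime p" and "p > 3" and "p mod 3 = 2" and "int p dvd a\<^sup>2 - a * b + b\<^sup>2"
  shows "int p dvd a"
proof -
  have odd_pow: "[x ^ (2 * p - 1) = x] (mod int p)" for x :: int
  proof -
    have "x ^ (2 * p - 1) = x ^ (p - 1) * x ^ p"
      using assms(2) by (simp add: power_add[symmetric] mult_2)
    also have "[\<dots> = x ^ (p - 1) * x] (mod int p)"
      by (intro cong_mult fermat_int' assms cong_refl)
    also have "x ^ (p - 1) * x = x ^ p"
      using assms(2) by (cases p) (auto simp: mult.commute)
    also have "[x ^ p = x] (mod int p)"
      by (intro fermat_int' assms)
    finally show ?thesis .
  qed
  define t where "t = p div 3"
  have t: "2 * p - 1 = 3 * (2 * t + 1)"
    using assms(3) unfolding t_def by presburger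
  have "a ^ 3 - (- b) ^ 3 = (a + b) * (a\<^sup>2 - a * b + b\<^sup>2)"
    by (simp add: power2_eq_square power3_eq_cube algebra_simps)
  then have "[a ^ 3 = (- b) ^ 3] (mod int p)"
    using assms(4) by (simp add: cong_iff_dvd_diff)
  then have "[a ^ (2 * p - 1) = (- b) ^ (2 * p - 1)] (mod int p)"
    unfolding t power_mult by (rule cong_pow)
  then have "[a = - b] (mod int p)"
    using odd_pow cong_sym cong_trans by metis
  then have "int p dvd a + b"
    by (simp add: cong_iff_dvd_diff)
  moreover have "3 * a\<^sup>2 = (a\<^sup>2 - a * b + b\<^sup>2) + (a + b) * (2 * a - b)"
    by (simp add: power2_eq_square algebra_simps)
  ultimately have "int p dvd 3 * a\<^sup>2"
    using assms(4) by (metis dvd_add dvd_mult2)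
  then have "int p dvd 3 \<or> int p dvd a"
    using assms(1) by (simp add: prime_dvd_mult_iff prime_dvd_power_iff)
  then show ?thesis
    using assms(2) by (auto dest: zdvd_imp_le)
qed

text \<open>Primality is read off from norms: \<open>p\<close> divides the norm of one of the
  factors, and by \<open>dvd_norm_inertD\<close> it then divides both coordinates of that
  factor.\<close>

lemma eis_prime_over_inert:
  assumes "prime p" and "p > 3" and "p mod 3 = 2"
  shows "eis_prime_over (of_nat p) p"
proof
  fix n assume "of_nat p dvd (of_int n :: eisenstein)"
  then have "of_int (int p) dvd (of_int n :: eisenstein)" by simp
  then show "int p dvd n"
    unfolding of_int_dvd_eis_iff by (simp add: of_int_eis)
next
  fix x y :: eisenstein
  have norm: "of_nat p dvd z" if "int p dvd eis_norm z" for z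
  proof -
    have "int p dvd (eis_fst z)\<^sup>2 - eis_fst z * eis_snd z + (eis_snd z)\<^sup>2"
      using that by (simp add: eis_norm_def)
    moreover from this have "int p dvd (eis_snd z)\<^sup>2 - eis_snd z * eis_fst z + (eis_fst z)\<^sup>2"
      by (simp add: algebra_simps)
    ultimately have "int p dvd eis_fst z" "int p dvd eis_snd z"
      using dvd_norm_inertD[OF assms] by blast+
    then show ?thesis
      using of_int_dvd_eis_iff[of "int p" z] by simp
  qed
  assume "of_nat p dvd x * y"
  then obtain z where "x * y = of_int (int p) * z" by (auto elim!: dvdE)
  then have "eis_norm x * eis_norm y = (int p)\<^sup>2 * eis_norm z"
    by (metis eis_norm_mult eis_norm_of_int)
  then have "int p dvd eis_norm x * eis_norm y"
    by (simp add: power2_eq_square)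
  then show "of_nat p dvd x \<or> of_nat p dvd y"
    using norm assms(1) by (auto simp: prime_dvd_mult_iff)
qed (use assms in auto)

lemma frobenius_add:
  fixes x y :: "'a::comm_ring_1"
  assumes "prime p"
  shows "ring_cong (of_nat p) ((x + y) ^ p) (x ^ p + y ^ p)"
proof -
  have p: "p > 0" using assms prime_gt_0_nat by simp
  have "(x + y) ^ p = (\<Sum>k\<le>p. of_nat (p choose k) * x ^ k * y ^ (p - k))"
    by (rule binomial_ring)
  also have "\<dots> = y ^ p + (x ^ p + (\<Sum>k\<in>{..p} - {0} - {p}. of_nat (p choose k) * x ^ k * y ^ (p - k)))"
    using p by (subst sum.remove[of _ 0], simp, simp, subst sum.remove[of _ p]) auto
  finally have eq: "(x + y) ^ p - (x ^ p + y ^ p) =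
      (\<Sum>k\<in>{..p} - {0} - {p}. of_nat (p choose k) * x ^ k * y ^ (p - k))"
    by simp
  have "of_nat p dvd (of_nat (p choose k) :: 'a)" if "k \<in> {..p} - {0} - {p}" for k
  proof -
    have "p dvd p choose k"
      using that assms by (intro dvd_choose_prime) auto
    then show ?thesis by (auto elim!: dvdE)
  qed
  then show ?thesis
    unfolding ring_cong_def eq by (intro dvd_sum dvd_mult2) auto
qed

text \<open>The \<open>p\<close>-th power is additive modulo \<open>p\<close>, fixes integers by
  Fermat, and sends \<omega> to its square since \<open>p mod 3 = 2\<close>. These properties
  characterise conjugation.\<close>

lemma frobenius_inert:
  assumes "prime p" and "p mod 3 = 2"
  shows "ring_cong (of_nat p) (x ^ p) (eis_cnj x)"
proof -
  let ?q = "of_nat p :: eisenstein"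
  define a b where "a = eis_fst x" and "b = eis_snd x"
  then have x: "x = of_int a + of_int b * omega"
    by (simp add: eis_eq_iff eis_arith)
  have "p = 3 * (p div 3) + 2"
    using assms(2) by presburger
  then have om: "omega ^ p = omega\<^sup>2"
    by (metis mult_1 omega_cube power_add power_mult power_one)
  have pow: "ring_cong ?q (of_int n ^ p) (of_int n)" for n
    using ring_cong_of_int[OF fermat_int'[OF assms(1)], of ?q n] by simp
  have "ring_cong ?q (x ^ p) (of_int a ^ p + (of_int b * omega) ^ p)"
    unfolding x by (rule frobenius_add[OF assms(1)])
  also have "ring_cong ?q \<dots> (of_int a + of_int b * omega\<^sup>2)"
    unfolding power_mult_distrib om by (intro ring_cong_add ring_cong_mult pow ring_cong_refl)
  also have "of_int a + of_int b * omega\<^sup>2 = eis_cnj x"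
    unfolding x omega_square by (simp add: eis_arith)
  finally show ?thesis .
qed

subsection \<open>Primary factors of split primes\<close>

text \<open>A primitive root raised to the power \<open>(p - 1) / 3\<close> is a cube root of 1
  other than 1.\<close>

lemma cube_root_mod_prime_exists:
  assumes "prime p" and "p mod 3 = 1"
  shows "\<exists>r::int. int p dvd r\<^sup>2 + r + 1"
proof -
  have "p > 1" using assms(1) prime_gt_1_nat by simp
  then obtain g where g: "residue_primroot p g"
    using prime_primitive_root_exists[of p] assms(1) by blast
  then have ord: "ord p g = p - 1"
    using totient_prime[OF assms(1)] by (simp add: residue_primroot_def)
  define E where "E = (p - 1) div 3"
  have E: "p - 1 = E * 3" "0 < E" "E < p - 1"
    using assms(2) \<open>p > 1\<close> unfolding E_def by presburger+
  have cube: "[g ^ (E * 3) = 1] (mod p)" and ne: "\<not> [g ^ E = 1] (mod p)"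
    using ord_works[of g p] E ord by auto
  define r where "r = int g ^ E"
  have "[r ^ 3 = 1] (mod int p)"
    using cube unfolding r_def power_mult[symmetric] by (metis cong_int_iff of_nat_1 of_nat_power)
  then have "int p dvd r ^ 3 - 1"
    by (simp add: cong_iff_dvd_diff)
  moreover have "r ^ 3 - 1 = (r - 1) * (r\<^sup>2 + r + 1)"
    by (simp add: power2_eq_square power3_eq_cube algebra_simps)
  ultimately have "int p dvd r - 1 \<or> int p dvd r\<^sup>2 + r + 1"
    using assms(1) by (simp add: prime_dvd_mult_iff)
  moreover have "\<not> int p dvd r - 1"
    using ne unfolding r_def cong_iff_dvd_diff[symmetric]
    by (metis cong_int_iff of_nat_1 of_nat_power)
  ultimately show ?thesis by blast
qed

text \<open>Thue's lemma. The pairs with entries in \<open>{0..s}\<close> outnumber the residues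
  modulo \<open>p\<close>, so two of them agree under \<open>x - r * y\<close>, and their difference
  is the required pair.\<close>

lemma thue_prime:
  fixes r :: int
  assumes "prime p"
  shows "\<exists>x y. (x \<noteq> 0 \<or> y \<noteq> 0) \<and> x\<^sup>2 < int p \<and> y\<^sup>2 < int p \<and> int p dvd x - r * y"
proof -
  \<comment> \<open>This is the integer part of the square root of \<open>p\<close>. The strict
    bound \<open>s^2 < p\<close> holds because a prime is not a square.\<close>
  define s where "s = (LEAST s. p < (s + 1)\<^sup>2)"
  have "p < (p + 1)\<^sup>2" by (simp add: power2_eq_square)
  then have s1: "p < (s + 1)\<^sup>2"
    unfolding s_def by (rule LeastI)
  have "s\<^sup>2 \<le> p"
  proof (cases s)
    case (Suc s')
    then have "\<not> p < (s' + 1)\<^sup>2"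
      using not_less_Least[of s' "\<lambda>s. p < (s + 1)\<^sup>2"] unfolding s_def by simp
    then show ?thesis using Suc by simp
  qed simp
  moreover have "s\<^sup>2 \<noteq> p"
    using assms prime_power_iff[of s 2] by auto
  ultimately have s2: "s\<^sup>2 < p" by simp
  let ?A = "{0..int s} \<times> {0..int s}"
  let ?f = "\<lambda>z. (fst z - r * snd z) mod int p"
  have "p > 0" using assms prime_gt_0_nat by simp
  then have "?f ` ?A \<subseteq> {0..<int p}" by auto
  then have "card (?f ` ?A) \<le> p"
    using card_mono[of "{0..<int p}"] by fastforce
  also have "p < card ?A"
    using s1 by (simp add: power2_eq_square card_cartesian_product nat_add_distrib)
  finally have "\<not> inj_on ?f ?A" by (rule pigeonhole)
  then obtain z w where zw: "z \<in> ?A" "w \<in> ?A" "?f z = ?f w" "z \<noteq> w"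
    by (auto simp only: inj_on_def)
  define x y where "x = fst z - fst w" and "y = snd z - snd w"
  have "x \<noteq> 0 \<or> y \<noteq> 0"
    using zw(4) by (auto simp: x_def y_def prod_eq_iff)
  moreover have "\<bar>x\<bar> \<le> int s" "\<bar>y\<bar> \<le> int s"
    using zw(1,2) by (auto simp: x_def y_def)
  then have "x\<^sup>2 \<le> (int s)\<^sup>2" "y\<^sup>2 \<le> (int s)\<^sup>2"
    by (simp_all add: abs_le_square_iff[symmetric])
  moreover have "(int s)\<^sup>2 < int p"
    using s2 by (metis of_nat_less_iff of_nat_power)
  moreover have "int p dvd (fst z - r * snd z) - (fst w - r * snd w)"
    using zw(3) by (simp add: mod_eq_dvd_iff)
  then have "int p dvd x - r * y"
    by (simp add: x_def y_def algebra_simps)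
  ultimately show ?thesis by (meson le_less_trans)
qed

text \<open>With \<open>x\<close> congruent to \<open>r * y\<close>, the form
  \<open>M = x^2 + x y + y^2\<close> is a multiple of \<open>p\<close> strictly between 0 and
  \<open>3 * p\<close>. The value \<open>2 * p\<close> is excluded by parity: if \<open>M\<close> is
  even, so are \<open>x\<close> and \<open>y\<close>, and 4 divides \<open>M\<close>.\<close>

lemma eis_norm_eq_prime_exists:
  assumes "prime p" and "p mod 3 = 1"
  shows "\<exists>q. eis_norm q = int p"
proof -
  obtain r :: int where r: "int p dvd r\<^sup>2 + r + 1"
    using cube_root_mod_prime_exists[OF assms] by blast
  obtain x y where xy: "x \<noteq> 0 \<or> y \<noteq> 0" "x\<^sup>2 < int p" "y\<^sup>2 < int p" "int p dvd x - r * y"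
    using thue_prime[OF assms(1)] by blast
  define M where "M = x\<^sup>2 + x * y + y\<^sup>2"
  have "M = (x - r * y) * (x + r * y + y) + y\<^sup>2 * (r\<^sup>2 + r + 1)"
    by (simp add: M_def power2_eq_square algebra_simps)
  then have "int p dvd M" using r xy(4) by simp
  then obtain t where t: "M = int p * t" ..
  have "4 * M = (2 * x + y)\<^sup>2 + 3 * y\<^sup>2"
    by (simp add: M_def power2_eq_square algebra_simps)
  moreover have "(2 * x + y)\<^sup>2 + 3 * y\<^sup>2 > 0"
  proof (cases "y = 0")
    case True
    then show ?thesis using xy(1) by simp
  next
    case False
    then have "3 * y\<^sup>2 > 0" by simp
    then show ?thesis by (smt (verit) zero_le_power2)
  qed
  ultimately have "M > 0" by simp
  have "2 * (x * y) \<le> x\<^sup>2 + y\<^sup>2"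
    using zero_le_power2[of "x - y"] by (simp add: power2_eq_square algebra_simps)
  then have "2 * M \<le> 3 * x\<^sup>2 + 3 * y\<^sup>2"
    by (simp add: M_def)
  then have "M < int p * 3" using xy(2,3) by simp
  then have "t < 3"
    unfolding t by (rule mult_less_cancel_left_pos[THEN iffD1, rotated])
      (use assms(1) prime_gt_0_nat in simp)
  moreover have "t > 0"
    using \<open>M > 0\<close> t by (simp add: zero_less_mult_iff)
  moreover have "t \<noteq> 2"
  proof
    assume "t = 2"
    then have "even M" by (simp add: t)
    then have "even x" "even y"
      by (auto simp: M_def)
    then obtain x' y' where "x = 2 * x'" "y = 2 * y'" by (auto elim!: evenE)
    then have "2 * int p = 2 * (2 * (x'\<^sup>2 + x' * y' + y'\<^sup>2))"
      using t \<open>t = 2\<close> by (simp add: M_def power2_eq_square algebra_simps)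
    then have "even (int p)" by presburger
    then have "p = 2"
      using primes_dvd_imp_eq[OF two_is_prime_nat assms(1)] by simp
    then show False using assms(2) by simp
  qed
  ultimately have "t = 1" by simp
  \<comment> \<open>The sign adjusts for the term \<open>- a b\<close> in the norm.\<close>
  then have "eis_norm (Eis x (- y)) = int p"
    using t by (simp add: eis_norm_def M_def)
  then show ?thesis ..
qed

text \<open>The norm of \<open>e + f \<omega>\<close> is congruent to \<open>(e + f)^2\<close>
  modulo 3, which leaves six residue classes. In each of them one of the six units moves
  \<open>q\<close> to the class of 2 without changing its norm.\<close>

lemma primary_factor_exists:
  assumes "prime p" and "p mod 3 = 1"
  shows "\<exists>q. of_nat p = q * eis_cnj q \<and> 3 dvd (q - 2)"
proof -
  obtain q where q: "eis_norm q = int p"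
    using eis_norm_eq_prime_exists[OF assms] by blast
  obtain e f where ef: "q = Eis e f" by (cases q)
  have "(e + f)\<^sup>2 = int p + 3 * (e * f)"
    using q by (simp add: ef eis_norm_def power2_eq_square algebra_simps)
  moreover have "int p mod 3 = 1" using assms(2) by presburger
  ultimately have "(e + f)\<^sup>2 mod 3 = 1" by presburger
  then have "(e + f) mod 3 \<noteq> 0"
    by (metis mod_0 power_mod zero_neq_one zero_power2)
  then have cases: "f mod 3 = 0 \<and> e mod 3 = 1 \<or> f mod 3 = 0 \<and> e mod 3 = 2 \<or>
      e mod 3 = 0 \<and> f mod 3 = 1 \<or> e mod 3 = 0 \<and> f mod 3 = 2 \<or>
      e mod 3 = 1 \<and> f mod 3 = 1 \<or> e mod 3 = 2 \<and> f mod 3 = 2"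
    by presburger
  have unit: "eis_norm 1 = 1" "eis_norm (- 1) = 1" "eis_norm omega = 1" "eis_norm (- omega) = 1"
      "eis_norm (1 + omega) = 1" "eis_norm (- 1 - omega) = 1"
    by (simp_all add: eis_norm_def eis_arith)
  have dvd3: "3 dvd x - 2 \<longleftrightarrow> 3 dvd eis_fst x - 2 \<and> 3 dvd eis_snd x" for x
    using of_int_dvd_eis_iff[of 3 "x - 2"] by (simp add: eis_arith)
  have "\<exists>u. eis_norm u = 1 \<and> 3 dvd q * u - 2"
    using cases
  proof (elim disjE)
    assume "f mod 3 = 0 \<and> e mod 3 = 1"
    then have "3 dvd q * (- 1) - 2" unfolding dvd3 ef by (simp add: eis_arith) presburger
    then show ?thesis using unit by blast
  next
    assume "f mod 3 = 0 \<and> e mod 3 = 2"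
    then have "3 dvd q * 1 - 2" unfolding dvd3 ef by (simp add: eis_arith) presburger
    then show ?thesis using unit by blast
  next
    assume "e mod 3 = 0 \<and> f mod 3 = 1"
    then have "3 dvd q * (1 + omega) - 2" unfolding dvd3 ef by (simp add: eis_arith) presburger
    then show ?thesis using unit by blast
  next
    assume "e mod 3 = 0 \<and> f mod 3 = 2"
    then have "3 dvd q * (- 1 - omega) - 2" unfolding dvd3 ef by (simp add: eis_arith) presburger
    then show ?thesis using unit by blast
  next
    assume "e mod 3 = 1 \<and> f mod 3 = 1"
    then have "3 dvd q * omega - 2" unfolding dvd3 ef by (simp add: eis_arith) presburger
    then show ?thesis using unit by blast
  next
    assume "e mod 3 = 2 \<and> f mod 3 = 2"
    then have "3 dvd q * (- omega) - 2" unfolding dvd3 ef by (simp add: eis_arith) presburger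
    then show ?thesis using unit by blast
  qed
  then obtain u where u: "eis_norm u = 1" "3 dvd q * u - 2" by blast
  have "of_nat p = (q * u) * eis_cnj (q * u)"
    unfolding eis_mult_cnj by (simp add: eis_norm_mult u(1) q)
  with u(2) show ?thesis by blast
qed

lemma primary_factor_norm:
  assumes "prime p" and "p mod 3 = 1"
  shows "eis_norm (primary_factor p) = int p"
proof -
  have "of_nat p = primary_factor p * eis_cnj (primary_factor p)"
    unfolding primary_factor_def using someI_ex[OF primary_factor_exists[OF assms]] by blast
  then show ?thesis
    unfolding eis_mult_cnj by (simp add: of_nat_eis of_int_eis)
qed

subsection \<open>The sum and the cubic residue symbol\<close>

text \<open>Here \<open>y\<close> stands for \<open>4 / (9 * N)\<close>. With
  \<open>h = (p + 1) / 2\<close> and \<open>k = h + i\<close>, the power of \<open>N\<close> on the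
  left turns \<open>y ^ k\<close> into \<open>(N * y) ^ h * (N * y) ^ i * N ^ (m - 1 - i)\<close>,
  where \<open>9 * (N * y) ^ h\<close> is congruent to 4 and \<open>- 27 * N * y\<close> to
  \<open>- 12\<close>.\<close>

lemma sum_triple_binomial_cong:
  fixes p m :: nat and e N y :: int
  assumes "prime p" and p: "int p = 6 * int m + e" and e: "e = 1 \<or> e = - 1"
    and y: "[9 * N * y = 4] (mod int p)"
  shows "[(\<Sum>k = (p + 1) div 2..(2 * p) div 3. int ((3 * k) choose k) * y ^ k)
        * N ^ (m - 1 + (p + 1) div 2) =
      - 4 * e * (\<Sum>i<m. int ((m + i) choose (2 * i + 1)) * N ^ (m - 1 - i) * (- 12) ^ i)]
      (mod int p)"
proof -
  define h where "h = (p + 1) div 2"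
  have "odd (int p)" using p e by auto
  then have "odd p" by simp
  then have h: "2 * h = p + 1"
    unfolding h_def by (auto elim!: oddE)
  have range: "{h..(2 * p) div 3} = {h..<h + m}"
  proof -
    \<comment> \<open>For both signs \<open>e\<close> the range of summation has exactly
      \<open>m\<close> elements.\<close>
    have "(2 * p) div 3 + 1 = h + m"
      using e
    proof
      assume "e = 1"
      then have "p = 6 * m + 1" using p by linarith
      then show ?thesis using h by simp
    next
      assume "e = - 1"
      then have "p + 1 = 6 * m" using p by linarith
      moreover from this obtain m' where "m = Suc m'" by (cases m) auto
      ultimately have "p = 6 * m' + 5" "h = 3 * m' + 3" "m = m' + 1" using h by auto
      then show ?thesis by simp
    qed
    then show ?thesis by (metis Suc_eq_plus1 atLeastLessThanSuc_atLeastAtMost)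
  qed
  \<comment> \<open>As \<open>2 * h = p + 1\<close>, Fermat makes the \<open>h\<close>-th power
    trivial on squares. It is applied to 9 and 4.\<close>
  have sq: "[(x\<^sup>2) ^ h = x\<^sup>2] (mod int p)" for x :: int
  proof -
    have "(x\<^sup>2) ^ h = x ^ p * x"
      unfolding power_mult[symmetric] h by simp
    also have "[\<dots> = x * x] (mod int p)"
      by (intro cong_mult cong_refl fermat_int' assms(1))
    finally show ?thesis by (simp add: power2_eq_square)
  qed
  have Ny_h: "[9 * (N * y) ^ h = 4] (mod int p)"
  proof -
    have "[9 * (N * y) ^ h = (3\<^sup>2) ^ h * (N * y) ^ h] (mod int p)"
      using sq[of 3] by (intro cong_mult cong_refl) (simp add: cong_sym)
    also have "(3\<^sup>2) ^ h * (N * y) ^ h = (9 * N * y) ^ h"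
      by (simp add: power_mult_distrib mult.assoc)
    also have "[\<dots> = 4 ^ h] (mod int p)"
      by (intro cong_pow y)
    also have "[4 ^ h = 4] (mod int p)"
      using sq[of 2] by simp
    finally show ?thesis .
  qed
  have "[- 3 * (9 * N * y) = - 3 * 4] (mod int p)"
    by (intro cong_mult cong_refl y)
  then have Ny: "[- 27 * (N * y) = - 12] (mod int p)"
    by (simp add: mult.assoc)
  have "(\<Sum>k = h..(2 * p) div 3. int ((3 * k) choose k) * y ^ k) =
      (\<Sum>i<m. int ((3 * (h + i)) choose (h + i)) * y ^ (h + i))"
    unfolding range
    by (rule sum.reindex_bij_witness[of _ "\<lambda>i. h + i" "\<lambda>k. k - h"]) auto
  then have "(\<Sum>k = h..(2 * p) div 3. int ((3 * k) choose k) * y ^ k) * N ^ (m - 1 + h) =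
      (\<Sum>i<m. int ((3 * (h + i)) choose (h + i)) * y ^ (h + i) * N ^ (m - 1 + h))"
    by (simp only: sum_distrib_right)
  also have "[\<dots> = (\<Sum>i<m. - 4 * e *
      (int ((m + i) choose (2 * i + 1)) * N ^ (m - 1 - i) * (- 12) ^ i))] (mod int p)"
  proof (rule cong_sum)
    fix i assume "i \<in> {..<m}"
    then have i: "i < m" by simp
    let ?B = "int ((m + i) choose (2 * i + 1))"
    have "m - 1 + h = h + i + (m - 1 - i)" using i by simp
    then have "int ((3 * (h + i)) choose (h + i)) * y ^ (h + i) * N ^ (m - 1 + h) =
        int ((3 * (h + i)) choose (h + i)) * ((N * y) ^ h * (N * y) ^ i * N ^ (m - 1 - i))"
      by (simp only: power_add power_mult_distrib mult_ac)
    also have "[\<dots> = - 9 * e * (- 27) ^ i * ?B * ((N * y) ^ h * (N * y) ^ i * N ^ (m - 1 - i))]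
        (mod int p)"
      unfolding h_def by (intro cong_mult cong_refl binomial_triple_cong assms i)
    also have "- 9 * e * (- 27) ^ i * ?B * ((N * y) ^ h * (N * y) ^ i * N ^ (m - 1 - i)) =
        - e * (9 * (N * y) ^ h) * (?B * N ^ (m - 1 - i) * (- 27 * (N * y)) ^ i)"
      by (simp only: power_mult_distrib[of "- 27" "N * y"]) (simp add: mult_ac)
    also have "[\<dots> = - e * 4 * (?B * N ^ (m - 1 - i) * (- 12) ^ i)] (mod int p)"
      by (intro cong_mult cong_refl cong_pow Ny Ny_h)
    finally show "[int ((3 * (h + i)) choose (h + i)) * y ^ (h + i) * N ^ (m - 1 + h) =
        - 4 * e * (?B * N ^ (m - 1 - i) * (- 12) ^ i)] (mod int p)"
      by (simp add: mult_ac)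
  qed
  finally show ?thesis
    by (simp only: sum_distrib_left h_def)
qed

lemma sqrt_minus_3: "(1 + 2 * omega) * (1 + 2 * omega) = - 3"
  by (simp add: eis_arith)

lemma eis_cnj_norm_form:
  "(of_int a + 1 + 2 * omega) * eis_cnj (of_int a + 1 + 2 * omega) = of_int (a\<^sup>2 + 3)"
  by (simp add: eis_arith power2_eq_square algebra_simps)

text \<open>The first Lucas identity is taken at \<open>u = x\<close> and
  \<open>v = eis_cnj x\<close>, where \<open>u * v = a^2 + 3\<close>,
  \<open>(u - v)^2 = - 12\<close> and \<open>u^2 - v^2 = (1 + 2 * omega) * 4 * a\<close>. The last
  value accounts for the factor \<open>a\<close> in front of the sum.\<close>

lemma sum_triple_binomial_eis_cong:
  fixes p m :: nat and e a y :: int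
  assumes "prime p" and p: "int p = 6 * int m + e" and e: "e = 1 \<or> e = - 1"
    and y: "[9 * (a\<^sup>2 + 3) * y = 4] (mod int p)"
  defines "T \<equiv> (\<Sum>k = (p + 1) div 2..(2 * p) div 3. int ((3 * k) choose k) * y ^ k)"
    and "x \<equiv> of_int a + 1 + 2 * omega"
  shows "ring_cong (of_nat p)
      ((1 + 2 * omega) * of_int (a * T) * of_int (a\<^sup>2 + 3) ^ (m - 1 + (p + 1) div 2))
      (of_int (- e) * (x ^ (2 * m) - eis_cnj x ^ (2 * m)))"
proof -
  let ?t = "1 + 2 * omega"
  let ?n = "m - 1 + (p + 1) div 2"
  define F where "F = (\<Sum>i<m. int ((m + i) choose (2 * i + 1)) * (a\<^sup>2 + 3) ^ (m - 1 - i) * (- 12) ^ i)"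
  have prod: "x * eis_cnj x = of_int (a\<^sup>2 + 3)"
    unfolding x_def by (rule eis_cnj_norm_form)
  have diff: "(x - eis_cnj x)\<^sup>2 = of_int (- 12)"
    by (simp add: x_def eis_arith power2_eq_square)
  have sq: "x\<^sup>2 - (eis_cnj x)\<^sup>2 = ?t * of_int (4 * a)"
    by (simp add: x_def eis_arith power2_eq_square algebra_simps)
  have F: "?t * of_int (4 * a) * of_int F = x ^ (2 * m) - eis_cnj x ^ (2 * m)"
    using lucas_sum_identities(1)[of x "eis_cnj x" m] unfolding prod diff sq F_def by simp
  have "[T * (a\<^sup>2 + 3) ^ ?n = - 4 * e * F] (mod int p)"
    unfolding T_def F_def by (rule sum_triple_binomial_cong[OF assms(1) p e y])
  then have "ring_cong (of_nat p :: eisenstein) (of_int (T * (a\<^sup>2 + 3) ^ ?n)) (of_int (- 4 * e * F))"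
    by (intro ring_cong_of_int) auto
  then have "ring_cong (of_nat p) (?t * of_int a * of_int (T * (a\<^sup>2 + 3) ^ ?n))
      (?t * of_int a * of_int (- 4 * e * F))"
    by (intro ring_cong_mult ring_cong_refl)
  moreover have "?t * of_int a * of_int (T * (a\<^sup>2 + 3) ^ ?n) =
      ?t * of_int (a * T) * of_int (a\<^sup>2 + 3) ^ ?n"
    by (simp only: of_int_mult of_int_power mult_ac)
  moreover have "?t * of_int a * of_int (- 4 * e * F) = of_int (- e) * (?t * of_int (4 * a) * of_int F)"
    by (simp add: mult_ac)
  ultimately show ?thesis
    unfolding F by (simp only:)
qed

section \<open>Evaluation by the cubic symbol, for split and inert primes\<close>

lemma ring_cong_dvd_mono: "ring_cong q x y \<Longrightarrow> r dvd q \<Longrightarrow> ring_cong r x y"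
  unfolding ring_cong_def by (rule dvd_trans)

context eis_prime_over
begin

lemma cong_cancel_left:
  assumes "ring_cong q (z * x) (z * y)" and "\<not> q dvd z"
  shows "ring_cong q x y"
  using assms prime_dvd_multD[of z "x - y"] by (simp add: ring_cong_def right_diff_distrib)

lemma not_dvd_of_int: "\<not> int p dvd n \<Longrightarrow> \<not> q dvd of_int n"
  using of_int_dvdD by blast

text \<open>For the three cube roots \<open>s - s^2\<close> is 0, 1 or \<open>- 1\<close> times
  \<open>1 + 2 * omega\<close>. This factor divides 3 and can be cancelled, leaving a congruence of
  integers that descends to \<open>p\<close>.\<close>

lemma cong_of_cube_root:
  assumes "ring_cong q ((1 + 2 * omega) * of_int n) (s - s\<^sup>2)"
  shows "s = omega ^ 0 \<Longrightarrow> [n = 0] (mod int p)"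
    and "s = omega ^ 1 \<Longrightarrow> [n = 1] (mod int p)"
    and "s = omega ^ 2 \<Longrightarrow> [n = - 1] (mod int p)"
proof -
  have "3 = (1 + 2 * omega) * (- (1 + 2 * omega))"
    by (simp only: mult_minus_right sqrt_minus_3) simp
  then have "\<not> q dvd 1 + 2 * omega"
    using not_dvd_if_dvd_3 dvd_triv_left by metis
  moreover have "ring_cong q ((1 + 2 * omega) * of_int n) ((1 + 2 * omega) * of_int l)"
    if "s - s\<^sup>2 = (1 + 2 * omega) * of_int l" for l
    using assms that by simp
  ultimately have "ring_cong q (of_int n) (of_int l)"
    if "s - s\<^sup>2 = (1 + 2 * omega) * of_int l" for l
    using that cong_cancel_left by blast
  then have main: "[n = l] (mod int p)" if "s - s\<^sup>2 = (1 + 2 * omega) * of_int l" for l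
    using that of_int_dvdD[of "n - l"] by (simp add: ring_cong_def cong_iff_dvd_diff)
  show "s = omega ^ 0 \<Longrightarrow> [n = 0] (mod int p)"
    by (rule main) simp
  show "s = omega ^ 1 \<Longrightarrow> [n = 1] (mod int p)"
    by (rule main) (simp add: omega_square)
  show "s = omega ^ 2 \<Longrightarrow> [n = - 1] (mod int p)"
    by (rule main) (simp add: omega_square, simp add: eis_arith power2_eq_square)
qed

end

text \<open>Conjugation squares a cube root of unity, so with \<open>t = z * w\<close> the product
  on the left expands to \<open>t^2 - t\<close> before the sign.\<close>

lemma cube_roots_symbol_identity:
  assumes "z \<in> {1, omega, omega\<^sup>2}" and "w \<in> {1, omega, omega\<^sup>2}"
  shows "- (z * eis_cnj w * (z - eis_cnj w)) = z * w - (z * w)\<^sup>2"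
proof -
  have "z \<in> {Eis 1 0, Eis 0 1, Eis (- 1) (- 1)}" "w \<in> {Eis 1 0, Eis 0 1, Eis (- 1) (- 1)}"
    using assms unfolding cube_roots_eis .
  then show ?thesis
    by (elim insertE) (simp_all add: eis_arith power2_eq_square)
qed

text \<open>Here \<open>2 * m = (p - 1) / 3\<close>, so modulo \<open>q\<close> the power of
  \<open>x\<close> is its character at \<open>q\<close>, while the power of \<open>eis_cnj x\<close>
  is the conjugate of its character at the other factor \<open>r\<close>. The symbol is the product
  of both characters.\<close>

lemma split_symbol_cong:
  fixes p m :: nat and a y :: int
  assumes "prime p" and p: "p = 6 * m + 1" and "p > 3"
    and N: "\<not> int p dvd a\<^sup>2 + 3"
    and y: "[9 * (a\<^sup>2 + 3) * y = 4] (mod int p)"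
  defines "T \<equiv> (\<Sum>k = (p + 1) div 2..(2 * p) div 3. int ((3 * k) choose k) * y ^ k)"
    and "x \<equiv> of_int a + 1 + 2 * omega"
  shows "ring_cong (primary_factor p) ((1 + 2 * omega) * of_int (a * T))
    (cubic_symbol x p - (cubic_symbol x p)\<^sup>2)"
proof -
  define q where "q = primary_factor p"
  define r where "r = eis_cnj q"
  have mod: "p mod 3 = 1" using p by presburger
  have norm: "eis_norm q = int p" "eis_norm r = int p"
    using primary_factor_norm[OF assms(1) mod] by (simp_all add: q_def r_def eis_norm_cnj)
  interpret q: eis_prime_over q p
    by (rule eis_prime_over_norm(1)[OF assms(1,3) norm(1)])
  interpret r: eis_prime_over r p
    by (rule eis_prime_over_norm(1)[OF assms(1,3) norm(2)])
  \<comment> \<open>Modulo an element of norm \<open>p\<close> every class contains an integer, so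
    the rational Fermat theorem suffices.\<close>
  have fermat: "ring_cong q' (z ^ (3 * (2 * m))) 1"
    if nq: "eis_norm q' = int p" and nd: "\<not> q' dvd z" for q' z
  proof -
    interpret q': eis_prime_over q' p
      by (rule eis_prime_over_norm(1)[OF assms(1,3) nq])
    obtain n where n: "ring_cong q' z (of_int n)"
      using eis_prime_over_norm(2)[OF assms(1,3) nq] by blast
    have "\<not> int p dvd n"
    proof
      assume "int p dvd n"
      then have "q' dvd of_int n"
        using ring_cong_of_int[OF iffD2[OF cong_0_iff] q'.dvd_p] by (simp add: ring_cong_def)
      then show False using nd ring_cong_dvd_iff[OF n] by simp
    qed
    then have "[n ^ (p - 1) = 1] (mod int p)"
      by (rule fermat_int[OF assms(1)])
    then have "ring_cong q' (of_int n ^ (p - 1)) 1"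
      using ring_cong_of_int[OF _ q'.dvd_p, of "n ^ (p - 1)" 1] by simp
    moreover have "p - 1 = 3 * (2 * m)" using p by simp
    ultimately show ?thesis
      using ring_cong_power[OF n] ring_cong_trans by metis
  qed
  have xx: "x * eis_cnj x = of_int (a\<^sup>2 + 3)"
    unfolding x_def by (rule eis_cnj_norm_form)
  have ndvd: "\<not> q dvd x" "\<not> r dvd x"
    using q.not_dvd_of_int[OF N] r.not_dvd_of_int[OF N] unfolding xx[symmetric] by auto
  have norm': "eis_norm q = 3 * int (2 * m) + 1" "eis_norm r = 3 * int (2 * m) + 1"
    using norm p by simp_all
  let ?z = "cubic_character q x" and ?w = "cubic_character r x"
  have z: "?z \<in> {1, omega, omega\<^sup>2}" "ring_cong q (x ^ (2 * m)) ?z"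
    using q.cubic_character_cong[OF ndvd(1) norm'(1) fermat[OF norm(1) ndvd(1)]] .
  have w: "?w \<in> {1, omega, omega\<^sup>2}" "ring_cong r (x ^ (2 * m)) ?w"
    using r.cubic_character_cong[OF ndvd(2) norm'(2) fermat[OF norm(2) ndvd(2)]] .
  \<comment> \<open>Conjugating the congruence modulo \<open>r\<close> gives one modulo
    \<open>q\<close>.\<close>
  from w(2) have w': "ring_cong q (eis_cnj x ^ (2 * m)) (eis_cnj ?w)"
    unfolding ring_cong_def r_def
    by (metis eis_cnj_cnj eis_cnj_diff eis_cnj_dvd eis_cnj_power)
  have symbol: "cubic_symbol x p = ?z * ?w"
    using mod by (simp add: cubic_symbol_def q_def r_def)
  let ?S = "(1 + 2 * omega) * of_int (a * T)" and ?N = "of_int (a\<^sup>2 + 3) :: eisenstein"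
  have "ring_cong (of_nat p) (?S * ?N ^ (m - 1 + (p + 1) div 2))
      (of_int (- 1) * (x ^ (2 * m) - eis_cnj x ^ (2 * m)))"
    unfolding T_def x_def
    by (rule sum_triple_binomial_eis_cong[OF assms(1) _ _ y]) (use p in auto)
  moreover have "m - 1 + (p + 1) div 2 = 4 * m"
    using p \<open>p > 3\<close> by simp
  ultimately have "ring_cong (of_nat p) (?S * ?N ^ (4 * m)) (- (x ^ (2 * m) - eis_cnj x ^ (2 * m)))"
    by simp
  then have "ring_cong q (?S * ?N ^ (4 * m)) (- (x ^ (2 * m) - eis_cnj x ^ (2 * m)))"
    using q.dvd_p by (rule ring_cong_dvd_mono)
  \<comment> \<open>The extra \<open>?N ^ (2 * m)\<close> does two things: on the left it completes
    the exponent to \<open>6 * m = p - 1\<close>, and on the right it supplies the product of the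
    two powers.\<close>
  then have "ring_cong q (?N ^ (2 * m) * (?S * ?N ^ (4 * m)))
      (?N ^ (2 * m) * (- (x ^ (2 * m) - eis_cnj x ^ (2 * m))))"
    by (intro ring_cong_mult ring_cong_refl)
  also have "?N ^ (2 * m) * (- (x ^ (2 * m) - eis_cnj x ^ (2 * m))) =
      - (x ^ (2 * m) * eis_cnj x ^ (2 * m) * (x ^ (2 * m) - eis_cnj x ^ (2 * m)))"
    unfolding xx[symmetric] power_mult_distrib by (rule mult_minus_right)
  also have "ring_cong q \<dots> (- (?z * eis_cnj ?w * (?z - eis_cnj ?w)))"
    by (intro ring_cong_minus ring_cong_mult ring_cong_diff z w')
  also have "\<dots> = cubic_symbol x p - (cubic_symbol x p)\<^sup>2"
    unfolding symbol by (rule cube_roots_symbol_identity[OF z(1) w(1)])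
  finally have main: "ring_cong q (?N ^ (2 * m) * (?S * ?N ^ (4 * m)))
      (cubic_symbol x p - (cubic_symbol x p)\<^sup>2)" .
  have "?N ^ (2 * m) * (?S * ?N ^ (4 * m)) = ?S * ?N ^ (3 * (2 * m))"
    by (simp add: mult_ac power_add[symmetric])
  moreover have "ring_cong q (?S * ?N ^ (3 * (2 * m))) (?S * 1)"
    by (intro ring_cong_mult ring_cong_refl fermat norm q.not_dvd_of_int N)
  ultimately have "ring_cong q ?S (?N ^ (2 * m) * (?S * ?N ^ (4 * m)))"
    using ring_cong_sym by (metis mult_1_right)
  then show ?thesis
    using main ring_cong_trans unfolding q_def by blast
qed

text \<open>With \<open>u = x ^ (2 * m)\<close> and \<open>v\<close> its conjugate, Frobenius gives
  \<open>v\<close> congruent to \<open>u ^ p\<close>, hence to \<open>u * s\<close>, because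
  \<open>u ^ (p - 1)\<close> is the character value \<open>s\<close>. Moreover
  \<open>u ^ 3 = x ^ (p + 1)\<close> is congruent to the norm of \<open>x\<close>.\<close>

lemma inert_symbol_cong:
  fixes p m :: nat and a y :: int
  assumes "prime p" and p: "p + 1 = 6 * m" and "p > 3"
    and N: "\<not> int p dvd a\<^sup>2 + 3"
    and y: "[9 * (a\<^sup>2 + 3) * y = 4] (mod int p)"
  defines "T \<equiv> (\<Sum>k = (p + 1) div 2..(2 * p) div 3. int ((3 * k) choose k) * y ^ k)"
    and "x \<equiv> of_int a + 1 + 2 * omega"
  shows "ring_cong (of_nat p) ((1 + 2 * omega) * of_int (a * T))
    (cubic_symbol x p - (cubic_symbol x p)\<^sup>2)"
proof -
  define q where "q = (of_nat p :: eisenstein)"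
  have mod: "p mod 3 = 2" using p by presburger
  interpret q: eis_prime_over q p
    unfolding q_def by (rule eis_prime_over_inert[OF assms(1,3) mod])
  have frob: "ring_cong q (z ^ p) (eis_cnj z)" for z
    unfolding q_def by (rule frobenius_inert[OF assms(1) mod])
  let ?N = "of_int (a\<^sup>2 + 3) :: eisenstein"
  have xx: "x * eis_cnj x = ?N"
    unfolding x_def by (rule eis_cnj_norm_form)
  have ndvd: "\<not> q dvd ?N" "\<not> q dvd x"
    using q.not_dvd_of_int[OF N] unfolding xx[symmetric] by auto
  \<comment> \<open>This is \<open>(p^2 - 1) / 3\<close>, the exponent in the character modulo
    \<open>p\<close>.\<close>
  define E where "E = 2 * m * (p - 1)"
  have E: "3 * E + 1 = p * p"
  proof -
    obtain p' where p': "p = Suc p'" using \<open>p > 3\<close> by (cases p) auto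
    have "3 * E = (p + 1) * (p - 1)" unfolding p E_def by simp
    then show ?thesis unfolding p' by simp
  qed
  \<comment> \<open>Frobenius applied twice is the identity; cancelling \<open>x\<close> yields
    Fermat's theorem modulo \<open>q\<close>.\<close>
  have "ring_cong q (x ^ (p * p)) (eis_cnj x ^ p)"
    unfolding power_mult by (intro ring_cong_power frob)
  also have "ring_cong q \<dots> x"
    using frob[of "eis_cnj x"] by (simp only: eis_cnj_cnj)
  finally have "ring_cong q (x * x ^ (3 * E)) (x * 1)"
    by (simp flip: E)
  then have x1: "ring_cong q (x ^ (3 * E)) 1"
    using ndvd(2) by (rule q.cong_cancel_left)
  have norm: "eis_norm q = 3 * int E + 1"
  proof -
    have "eis_norm q = int (p * p)"
      by (simp add: q_def eis_norm_def of_nat_eis power2_eq_square)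
    then show ?thesis unfolding E[symmetric] by simp
  qed
  define s where "s = cubic_symbol x p"
  define u v where "u = x ^ (2 * m)" and "v = eis_cnj x ^ (2 * m)"
  have s: "ring_cong q (u ^ (p - 1)) s"
    using q.cubic_character_cong(2)[OF ndvd(2) norm x1] mod
    by (simp add: s_def cubic_symbol_def q_def E_def u_def power_mult)
  have us: "ring_cong q (u * s) v"
  proof -
    have "ring_cong q (u * s) (u * u ^ (p - 1))"
      by (intro ring_cong_mult ring_cong_refl ring_cong_sym[OF s])
    also have "u * u ^ (p - 1) = u ^ p"
      using \<open>p > 3\<close> by (cases p) auto
    also have "ring_cong q \<dots> (eis_cnj u)" by (rule frob)
    also have "eis_cnj u = v" by (simp add: u_def v_def eis_cnj_power)
    finally show ?thesis .
  qed
  have u3: "ring_cong q (u ^ 3) ?N"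
  proof -
    have "u ^ 3 = x ^ (p + 1)"
      unfolding p u_def by (simp add: power_mult[symmetric] mult.commute)
    also have "\<dots> = x * x ^ p" by simp
    also have "ring_cong q \<dots> (x * eis_cnj x)"
      by (intro ring_cong_mult ring_cong_refl frob)
    finally show ?thesis unfolding xx .
  qed
  let ?S = "(1 + 2 * omega) * of_int (a * T)"
  have "ring_cong q (?S * ?N ^ (m - 1 + (p + 1) div 2)) (of_int (- (- 1)) * (u - v))"
    unfolding T_def x_def q_def u_def v_def
    by (rule sum_triple_binomial_eis_cong[OF assms(1) _ _ y]) (use p in auto)
  moreover have "m - 1 + (p + 1) div 2 = 4 * m - 1"
    using p \<open>p > 3\<close> by simp
  ultimately have S: "ring_cong q (?S * ?N ^ (4 * m - 1)) (u - v)"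
    by simp
  have N1: "ring_cong q (?N ^ (p - 1)) 1"
    using ring_cong_of_int[OF fermat_int[OF assms(1) N], of q] by (simp add: q_def)
  \<comment> \<open>The exponents add up to \<open>p\<close>, not \<open>p - 1\<close>, so one
    factor \<open>?N\<close> remains on the left. It is cancelled against \<open>u ^ 3\<close> at
    the end.\<close>
  have exps: "2 * m + (4 * m - 1) = Suc (p - 1)"
    using p \<open>p > 3\<close> by simp
  have "?N * (?S * 1) = ?N * ?S * 1" by simp
  also have "ring_cong q \<dots> (?N * ?S * ?N ^ (p - 1))"
    by (intro ring_cong_mult ring_cong_refl ring_cong_sym[OF N1])
  also have "?N * ?S * ?N ^ (p - 1) = ?N ^ (2 * m) * (?S * ?N ^ (4 * m - 1))"
  proof -
    have "?N * ?S * ?N ^ (p - 1) = ?S * ?N ^ Suc (p - 1)" by (simp add: mult_ac)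
    then show ?thesis unfolding exps[symmetric] power_add by (simp only: mult_ac)
  qed
  also have "ring_cong q \<dots> (?N ^ (2 * m) * (u - v))"
    by (intro ring_cong_mult ring_cong_refl S)
  also have "?N ^ (2 * m) * (u - v) = u * v * (u - v)"
    unfolding xx[symmetric] power_mult_distrib u_def v_def ..
  also have "ring_cong q \<dots> (u * (u * s) * (u - u * s))"
    by (intro ring_cong_mult ring_cong_diff ring_cong_refl ring_cong_sym[OF us])
  also have "u * (u * s) * (u - u * s) = u ^ 3 * (s - s\<^sup>2)"
    by (simp add: power2_eq_square power3_eq_cube algebra_simps)
  also have "ring_cong q \<dots> (?N * (s - s\<^sup>2))"
    by (intro ring_cong_mult ring_cong_refl u3)
  finally have "ring_cong q (?N * ?S) (?N * (s - s\<^sup>2))" by simp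
  then have "ring_cong q ?S (s - s\<^sup>2)"
    using ndvd(1) by (rule q.cong_cancel_left)
  then show ?thesis by (simp only: q_def s_def)
qed

lemma prime_mod_6:
  assumes "prime p" and "p > (3::nat)"
  obtains m where "p = 6 * m + 1" | m where "p + 1 = 6 * m"
proof -
  have "\<not> 2 dvd p" "\<not> 3 dvd p"
    using assms primes_dvd_imp_eq[of 2 p] primes_dvd_imp_eq[of 3 p] by auto
  then have "p mod 6 = 1 \<or> p mod 6 = 5" by presburger
  then have "p = 6 * (p div 6) + 1 \<or> p + 1 = 6 * (p div 6 + 1)" by presburger
  then show thesis using that by blast
qed

text \<open>The split and inert cases agree up to the modulus \<open>q\<close>, which disappears
  again in the integer congruences.\<close>

lemma sum_triple_binomial_cubic_symbol:
  fixes a y :: int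
  assumes "prime p" and "p > 3" and N: "\<not> int p dvd a\<^sup>2 + 3"
    and y: "[9 * (a\<^sup>2 + 3) * y = 4] (mod int p)"
  defines "n \<equiv> a * (\<Sum>k = (p + 1) div 2..(2 * p) div 3. int ((3 * k) choose k) * y ^ k)"
    and "s \<equiv> cubic_symbol (of_int a + 1 + 2 * omega) p"
  shows "s = omega ^ 0 \<Longrightarrow> [n = 0] (mod int p)"
    and "s = omega ^ 1 \<Longrightarrow> [n = 1] (mod int p)"
    and "s = omega ^ 2 \<Longrightarrow> [n = - 1] (mod int p)"
proof -
  have "\<exists>q. eis_prime_over q p \<and> ring_cong q ((1 + 2 * omega) * of_int n) (s - s\<^sup>2)"
    using assms(1,2)
  proof (cases rule: prime_mod_6)
    case (1 m)
    then have "p mod 3 = 1" by presburger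
    then have "eis_prime_over (primary_factor p) p"
      using primary_factor_norm eis_prime_over_norm assms(1,2) by blast
    then show ?thesis
      using split_symbol_cong[OF assms(1) 1 assms(2) N y] unfolding n_def s_def by blast
  next
    case (2 m)
    then have "p mod 3 = 2" by presburger
    then have "eis_prime_over (of_nat p) p"
      using eis_prime_over_inert assms(1,2) by blast
    then show ?thesis
      using inert_symbol_cong[OF assms(1) 2 assms(2) N y] unfolding n_def s_def by blast
  qed
  then obtain q where q: "eis_prime_over q p" "ring_cong q ((1 + 2 * omega) * of_int n) (s - s\<^sup>2)"
    by blast
  show "s = omega ^ 0 \<Longrightarrow> [n = 0] (mod int p)" "s = omega ^ 1 \<Longrightarrow> [n = 1] (mod int p)"
    "s = omega ^ 2 \<Longrightarrow> [n = - 1] (mod int p)"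
    using eis_prime_over.cong_of_cube_root[OF q] by blast+
qed

subsection \<open>Rationals with denominator prime to \<open>p\<close>\<close>

text \<open>Any fraction may be used, not only the reduced one, because the reduced denominator
  divides every other.\<close>

lemma D_iff:
  assumes "prime p"
  shows "x \<in> D p \<longleftrightarrow> (\<exists>a b. \<not> int p dvd b \<and> x = of_int a / of_int b)"
proof
  assume "x \<in> D p"
  moreover obtain a b where ab: "quotient_of x = (a, b)" by fastforce
  ultimately show "\<exists>a b. \<not> int p dvd b \<and> x = of_int a / of_int b"
    using quotient_of_div[OF ab] by (auto simp: D_def)
next
  assume "\<exists>a b. \<not> int p dvd b \<and> x = of_int a / of_int b"
  then obtain a b where ab: "\<not> int p dvd b" "x = of_int a / of_int b" by blast
  obtain c d where cd: "quotient_of x = (c, d)" by fastforce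
  have "d > 0" "coprime c d" "x = of_int c / of_int d"
    using quotient_of_denom_pos[OF cd] quotient_of_coprime[OF cd] quotient_of_div[OF cd] by auto
  moreover have "b \<noteq> 0" using ab(1) by auto
  ultimately have "(of_int (c * b) :: rat) = of_int (a * d)"
    using ab(2) by (simp add: field_simps)
  then have "c * b = a * d" by (simp only: of_int_eq_iff)
  then have "d dvd b * c" by (simp add: mult.commute)
  then have "d dvd b"
    using \<open>coprime c d\<close> by (simp add: coprime_commute coprime_dvd_mult_left_iff)
  then have "\<not> int p dvd d" using ab(1) dvd_trans by blast
  then show "x \<in> D p" by (simp add: D_def cd)
qed

lemma D_of_int:
  assumes "prime p"
  shows "of_int n \<in> D p"
proof -
  have "\<not> int p dvd 1" using assms by (simp add: prime_nat_iff)
  then show ?thesis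
    unfolding D_iff[OF assms] by (intro exI[of _ n] exI[of _ 1]) simp
qed

lemma D_add_mult:
  assumes "prime p" and "x \<in> D p" and "y \<in> D p"
  shows "x + y \<in> D p" and "x * y \<in> D p"
proof -
  obtain a b c d where *: "\<not> int p dvd b" "x = of_int a / of_int b"
      "\<not> int p dvd d" "y = of_int c / of_int d"
    using assms unfolding D_iff[OF assms(1)] by blast
  have bd: "\<not> int p dvd b * d"
    using *(1,3) assms(1) by (simp add: prime_dvd_mult_iff)
  have "b \<noteq> 0" "d \<noteq> 0" using *(1,3) by auto
  then have "x + y = of_int (a * d + c * b) / of_int (b * d)" "x * y = of_int (a * c) / of_int (b * d)"
    by (simp_all add: *(2,4) field_simps)
  with bd show "x + y \<in> D p" "x * y \<in> D p"
    unfolding D_iff[OF assms(1)] by blast+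
qed

context
  fixes p :: nat
  assumes prime_p: "prime p"
begin

lemma D_diff: "x \<in> D p \<Longrightarrow> y \<in> D p \<Longrightarrow> x - y \<in> D p"
  using D_add_mult[OF prime_p, of x "of_int (- 1) * y"] D_add_mult[OF prime_p _ , of "of_int (- 1)" y]
    D_of_int[OF prime_p, of "- 1"] by simp

lemma D_power: "x \<in> D p \<Longrightarrow> x ^ n \<in> D p"
  using D_of_int[OF prime_p, of 1] by (induction n) (simp_all add: D_add_mult[OF prime_p])

lemma rat_cong_refl: "rat_cong p x x"
  using D_of_int[OF prime_p, of 0] by (force simp: rat_cong_def)

lemma rat_cong_add: "rat_cong p x y \<Longrightarrow> rat_cong p z w \<Longrightarrow> rat_cong p (x + z) (y + w)"
  unfolding rat_cong_def
proof (elim bexE)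
  fix d e assume "d \<in> D p" "x - y = of_nat p * d" "e \<in> D p" "z - w = of_nat p * e"
  then show "\<exists>f\<in>D p. x + z - (y + w) = of_nat p * f"
    by (intro bexI[of _ "d + e"]) (simp_all add: D_add_mult[OF prime_p] algebra_simps)
qed

text \<open>The membership conditions are those that keep the cofactor \<open>d * z + y * e\<close>
  in \<open>D p\<close>.\<close>

lemma rat_cong_mult:
  assumes "rat_cong p x y" "rat_cong p z w" "z \<in> D p" "y \<in> D p"
  shows "rat_cong p (x * z) (y * w)"
proof -
  obtain d e where de: "d \<in> D p" "x - y = of_nat p * d" "e \<in> D p" "z - w = of_nat p * e"
    using assms unfolding rat_cong_def by blast
  have "x * z - y * w = (x - y) * z + y * (z - w)" by (simp add: algebra_simps)
  also have "\<dots> = of_nat p * (d * z + y * e)" unfolding de by (simp add: algebra_simps)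
  finally show ?thesis
    unfolding rat_cong_def using de assms D_add_mult[OF prime_p] by blast
qed

lemma rat_cong_sym: "rat_cong p x y \<Longrightarrow> rat_cong p y x"
  unfolding rat_cong_def
proof (elim bexE)
  fix d assume "d \<in> D p" "x - y = of_nat p * d"
  then show "\<exists>f\<in>D p. y - x = of_nat p * f"
    using D_diff[of "of_int 0" d] D_of_int[OF prime_p, of 0]
    by (intro bexI[of _ "- d"]) (simp_all add: algebra_simps)
qed

lemma rat_cong_trans: "rat_cong p x y \<Longrightarrow> rat_cong p y z \<Longrightarrow> rat_cong p x z"
  using rat_cong_add[of x y y z] by (simp add: rat_cong_def)

lemma rat_cong_power:
  assumes "rat_cong p x y" "x \<in> D p" "y \<in> D p"
  shows "rat_cong p (x ^ n) (y ^ n)"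
  using assms by (induction n) (simp_all add: rat_cong_refl rat_cong_mult D_power)

lemma rat_cong_sum:
  "(\<And>k. k \<in> A \<Longrightarrow> rat_cong p (f k) (g k)) \<Longrightarrow> rat_cong p (\<Sum>k\<in>A. f k) (\<Sum>k\<in>A. g k)"
  by (induction A rule: infinite_finite_induct) (simp_all add: rat_cong_refl rat_cong_add)

lemma rat_cong_of_int_iff: "rat_cong p (of_int a) (of_int b) \<longleftrightarrow> [a = b] (mod int p)"
proof
  assume "rat_cong p (of_int a) (of_int b)"
  then obtain c d where cd: "\<not> int p dvd d" "of_int a - of_int b = of_nat p * (of_int c / of_int d :: rat)"
    unfolding rat_cong_def Bex_def D_iff[OF prime_p] by blast
  then have "d \<noteq> 0" by auto
  with cd(2) have "(of_int ((a - b) * d) :: rat) = of_int (int p * c)"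
    by (simp add: field_simps)
  then have "(a - b) * d = int p * c" by (simp only: of_int_eq_iff)
  then have "int p dvd (a - b) * d" by simp
  then have "int p dvd a - b"
    using cd(1) prime_p by (simp add: prime_dvd_mult_iff)
  then show "[a = b] (mod int p)"
    by (simp add: cong_iff_dvd_diff)
next
  assume "[a = b] (mod int p)"
  then obtain c where "a - b = int p * c"
    by (auto simp: cong_iff_dvd_diff)
  then have "(of_int a - of_int b :: rat) = of_nat p * of_int c"
    by (metis of_int_diff of_int_mult of_int_of_nat_eq)
  then show "rat_cong p (of_int a) (of_int b)"
    unfolding rat_cong_def using D_of_int[OF prime_p] by blast
qed

lemma D_inverse:
  assumes "x \<in> D p" and "\<not> rat_cong p x 0"
  shows "inverse x \<in> D p"
proof -
  obtain a b where ab: "\<not> int p dvd b" "x = of_int a / of_int b"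
    using assms(1) unfolding D_iff[OF prime_p] by blast
  have "\<not> int p dvd a"
  proof
    assume "int p dvd a"
    then obtain c where "a = int p * c" ..
    then have "x - 0 = of_nat p * (of_int c / of_int b)" by (simp add: ab)
    then show False
      using assms(2) ab(1) unfolding rat_cong_def Bex_def D_iff[OF prime_p] by blast
  qed
  then show ?thesis
    unfolding D_iff[OF prime_p] ab(2) by (metis inverse_divide)
qed

text \<open>Justifies the \<open>THE\<close> in \<open>D_residue\<close>: for
  \<open>x = a / b\<close> the residue is \<open>a * b'\<close> modulo \<open>p\<close>, with
  \<open>b'\<close> inverse to \<open>b\<close>, and congruent residues in \<open>{0..<p}\<close>
  coincide.\<close>

lemma rat_cong_D_residue:
  assumes "x \<in> D p"
  shows "rat_cong p x (of_int (D_residue p x))"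
proof -
  have p0: "int p > 0" using prime_p prime_gt_0_nat by simp
  obtain a b where ab: "\<not> int p dvd b" "x = of_int a / of_int b"
    using assms(1) unfolding D_iff[OF prime_p] by blast
  have "coprime b (int p)"
    using ab(1) prime_p prime_imp_coprime[of "int p" b] by (simp add: coprime_commute)
  then obtain b' where b': "[b * b' = 1] (mod int p)"
    using cong_solve_coprime_int by blast
  define r where "r = (a * b') mod int p"
  have "[r * b = a * b' * b] (mod int p)"
    unfolding r_def by (intro cong_mult cong_refl) (simp add: cong_def)
  also have "a * b' * b = a * (b * b')" by (simp only: mult_ac)
  also have "[\<dots> = a * 1] (mod int p)"
    by (intro cong_mult cong_refl b')
  finally have "[a = r * b] (mod int p)"
    by (simp add: cong_sym)
  then obtain c where c: "a - r * b = int p * c"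
    by (auto simp: cong_iff_dvd_diff)
  have "b \<noteq> 0" using ab(1) by auto
  then have "x - of_int r = of_int (a - r * b) / of_int b"
    unfolding ab(2) by (simp add: field_simps)
  also have "\<dots> = of_nat p * (of_int c / of_int b)"
    unfolding c by simp
  finally have xr: "rat_cong p x (of_int r)"
    using ab(1) unfolding rat_cong_def Bex_def D_iff[OF prime_p] by blast
  have r: "0 \<le> r" "r < int p" using p0 by (simp_all add: r_def)
  have "D_residue p x = r"
    unfolding D_residue_def
  proof (rule the_equality)
    show "0 \<le> r \<and> r < int p \<and> rat_cong p x (of_int r)" using r xr by blast
  next
    fix s assume s: "0 \<le> s \<and> s < int p \<and> rat_cong p x (of_int s)"
    then have "[s = r] (mod int p)"
      using xr rat_cong_sym rat_cong_trans rat_cong_of_int_iff by blast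
    then show "s = r" using s r by (simp add: cong_def)
  qed
  then show ?thesis using xr by simp
qed

end

section \<open>Transfer of the integer congruences to the rational sum\<close>

theorem theorem24:
  fixes p :: nat and c :: rat
  assumes "prime p" and "p > 3"
    and "c \<in> D p" and "\<not> rat_cong p (c\<^sup>2) (- 3)"
  defines "S \<equiv> c * (\<Sum>k = (p + 1) div 2..(2 * p) div 3.
                       of_nat ((3 * k) choose k) * (4 / (9 * (c\<^sup>2 + 3))) ^ k)"
  shows "(c \<in> C 0 p \<longrightarrow> rat_cong p S 0) \<and>
         (c \<in> C 1 p \<longrightarrow> rat_cong p S 1) \<and>
         (c \<in> C 2 p \<longrightarrow> rat_cong p S (- 1))"
proof -
  note prime = \<open>prime p\<close>
  define a where "a = D_residue p c"
  let ?N = "a\<^sup>2 + 3"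
  note Dint = D_of_int[OF prime]
  have ca: "rat_cong p c (of_int a)"
    unfolding a_def by (rule rat_cong_D_residue[OF prime assms(3)])
  have c2: "rat_cong p (c\<^sup>2) (of_int (a\<^sup>2))"
    using rat_cong_power[OF prime ca assms(3) Dint, of 2] by simp
  have N: "\<not> int p dvd ?N"
  proof
    assume "int p dvd ?N"
    then have "[a\<^sup>2 = - 3] (mod int p)" by (simp add: cong_iff_dvd_diff)
    then have "rat_cong p (of_int (a\<^sup>2)) (of_int (- 3))"
      by (simp only: rat_cong_of_int_iff[OF prime])
    with c2 have "rat_cong p (c\<^sup>2) (of_int (- 3))"
      by (rule rat_cong_trans[OF prime])
    then show False using assms(4) by simp
  qed
  have N9: "\<not> int p dvd 9 * ?N"
  proof
    assume "int p dvd 9 * ?N"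
    then have "int p dvd 9 \<or> int p dvd ?N"
      by (rule prime_dvd_multD[rotated]) (use prime in simp)
    then have "int p dvd 3 ^ 2"
      using N by simp
    then have "int p dvd 3"
      by (rule prime_dvd_power[rotated]) (use prime in simp)
    then show False using assms(2) by (auto dest: zdvd_imp_le)
  qed
  then have "coprime (9 * ?N) (int p)"
    using prime prime_imp_coprime[of "int p" "9 * ?N"] by (simp add: coprime_commute)
  then obtain z where z: "[9 * ?N * z = 1] (mod int p)"
    using cong_solve_coprime_int by blast
  \<comment> \<open>An integer representing \<open>4 / (9 * (c^2 + 3))\<close> modulo
    \<open>p\<close>; \<open>wy\<close> below confirms this.\<close>
  define y where "y = 4 * z"
  have y: "[9 * ?N * y = 4] (mod int p)"
    using cong_scalar_right[OF z, of 4] by (simp add: y_def mult_ac)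
  let ?d = "9 * (c\<^sup>2 + 3)"
  have "rat_cong p (of_int 9 * (c\<^sup>2 + of_int 3)) (of_int 9 * (of_int (a\<^sup>2) + of_int 3))"
    by (intro rat_cong_mult[OF prime] rat_cong_add[OF prime] rat_cong_refl[OF prime] c2
        D_add_mult[OF prime] D_power[OF prime] assms(3) Dint)
  then have d: "rat_cong p ?d (of_int (9 * ?N))" by simp
  have "of_int 9 * (c\<^sup>2 + of_int 3) \<in> D p"
    by (intro D_add_mult[OF prime] D_power[OF prime] assms(3) Dint)
  then have dD: "?d \<in> D p" by simp
  have d0: "\<not> rat_cong p ?d 0"
  proof
    assume "rat_cong p ?d 0"
    then have "rat_cong p (of_int (9 * ?N)) (of_int 0)"
      using rat_cong_trans[OF prime rat_cong_sym[OF prime d]] by simp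
    then show False
      using N9 unfolding rat_cong_of_int_iff[OF prime] by (simp only: cong_0_iff)
  qed
  \<comment> \<open>Nonzero as a rational number, so that \<open>inverse ?d\<close> is a true
    inverse rather than the default value 0.\<close>
  then have "?d \<noteq> 0" using rat_cong_refl[OF prime, of 0] by metis
  have inv: "inverse ?d \<in> D p"
    by (rule D_inverse[OF prime dD d0])
  let ?w = "4 / ?d"
  have wD: "?w \<in> D p"
    using D_add_mult(2)[OF prime Dint[of 4] inv] by (simp add: divide_inverse)
  have "rat_cong p (?d * of_int y) (of_int (9 * ?N) * of_int y)"
    by (intro rat_cong_mult[OF prime] d rat_cong_refl[OF prime] Dint)
  also have "of_int (9 * ?N) * of_int y = (of_int (9 * ?N * y) :: rat)" by simp
  finally have "rat_cong p (?d * of_int y) (of_int 4)"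
    using y rat_cong_of_int_iff[OF prime] rat_cong_trans[OF prime] by blast
  then have "rat_cong p (inverse ?d * (?d * of_int y)) (inverse ?d * of_int 4)"
    by (intro rat_cong_mult[OF prime] rat_cong_refl[OF prime] inv D_add_mult[OF prime] dD Dint)
  moreover have "inverse ?d * (?d * of_int y) = of_int y"
    using \<open>?d \<noteq> 0\<close> by (metis left_inverse mult.assoc mult_1)
  moreover have "inverse ?d * of_int 4 = ?w"
    by (simp only: divide_inverse of_int_numeral mult.commute)
  ultimately have wy: "rat_cong p ?w (of_int y)"
    using rat_cong_sym[OF prime] by metis
  define T where "T = (\<Sum>k = (p + 1) div 2..(2 * p) div 3. int ((3 * k) choose k) * y ^ k)"
  \<comment> \<open>Needed as a side condition of \<open>rat_cong_mult\<close> when the sum is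
    multiplied by \<open>c\<close>.\<close>
  have sumD: "(\<Sum>k\<in>A. of_nat ((3 * k) choose k) * ?w ^ k) \<in> D p" for A :: "nat set"
  proof (induction A rule: infinite_finite_induct)
    case (insert k A)
    have "of_int (int ((3 * k) choose k)) * ?w ^ k \<in> D p"
      by (intro D_add_mult[OF prime] D_power[OF prime] wD Dint)
    then show ?case using insert D_add_mult[OF prime] by simp
  qed (use Dint[of 0] in simp_all)
  have "rat_cong p (of_int (int ((3 * k) choose k)) * ?w ^ k) (of_int (int ((3 * k) choose k)) * of_int y ^ k)" for k
    by (intro rat_cong_mult[OF prime] rat_cong_refl[OF prime] rat_cong_power[OF prime] wy wD Dint
        D_power[OF prime])
  then have "rat_cong p (\<Sum>k = (p + 1) div 2..(2 * p) div 3. of_nat ((3 * k) choose k) * ?w ^ k)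
      (\<Sum>k = (p + 1) div 2..(2 * p) div 3. of_nat ((3 * k) choose k) * of_int y ^ k)"
    by (intro rat_cong_sum[OF prime]) simp
  then have "rat_cong p (\<Sum>k = (p + 1) div 2..(2 * p) div 3. of_nat ((3 * k) choose k) * ?w ^ k)
      (of_int T)"
    by (simp add: T_def)
  then have "rat_cong p S (of_int a * of_int T)"
    unfolding S_def by (intro rat_cong_mult[OF prime] ca sumD Dint)
  then have S: "rat_cong p S (of_int (a * T))" by simp
  then have main: "rat_cong p S (of_int l)" if "[a * T = l] (mod int p)" for l
    using that rat_cong_of_int_iff[OF prime] rat_cong_trans[OF prime] by blast
  note symbol = sum_triple_binomial_cubic_symbol[OF prime assms(2) N y, folded T_def]
  show ?thesis
    using main[OF symbol(1)] main[OF symbol(2)] main[OF symbol(3)]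
    by (simp add: C_def a_def)
qed

end
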